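(* Let $A,B$ be a pair of $L_2$-zonoids in $\mathbb{R}^n$ and let $u\in S^{n-1}$. Then $$\left(\frac{|A\oplus_2B|}{|P_{u^\perp}(A\oplus_2B)|_{n-1}}\right)^2\ge\left(\frac{|A|}{|P_{u^\perp}A|_{n-1}}\right)^2+\left(\frac{|B|}{|P_{u^\perp}B|_{n-1}}\right)^2,$$ with equality if and only if $A$ and $B$ have parallel tangent hyperplanes at $\rho_A(u)u$ and $\rho_B(u)u$.
   Context: $h_K(x)=\max_{y\in K}\langle x,y\rangle$ is the support function. For compact convex sets $K,L$ containing the origin and $p\ge1$, the $\ell_p$-sum $K\oplus_pL$ is the compact convex set with support function $h_{K\oplus_pL}(x)=(h_K(x)^p+h_L(x)^p)^{1/p}$. An $L_p$-zonotope is an $\ell_p$-sum of finitely many centered segments $[-w,w]$; an $L_p$-zonoid is a Hausdorff limit of $L_p$-zonotopes. (For $p=2$ an $L_2$-zonoid is always an origin-centered ellipsoid, possibly living in a lower-dimensional subspace.) $|\cdot|$ is $n$-dimensional volume, $|\cdot|_{n-1}$ is $(n-1)$-dimensional volume, $S^{n-1}$ is the Euclidean unit sphere, $P_{u^\perp}$ is the orthogonal projection onto the hyperplane $u^\perp$ orthogonal to $u$. $\rho_K(u)=\sup\{a: au\in K\}$ is the radial function. *)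

theory Defs
  imports "HOL-Analysis.Analysis"
begin

definition support_fun :: "'a::euclidean_space set \<Rightarrow> 'a \<Rightarrow> real" where
  "support_fun K x = (SUP y\<in>K. x \<bullet> y)"

text \<open>A compact convex set is determined by its support function, so the description below
  has at most one solution; for compact convex \<open>K\<close>, \<open>L\<close> containing the origin and \<open>p \<ge> 1\<close> the
  prescribed function is sublinear, so a solution exists.\<close>

definition lp_sum :: "real \<Rightarrow> 'a::euclidean_space set \<Rightarrow> 'a set \<Rightarrow> 'a set" where
  "lp_sum p K L = (THE M. compact M \<and> convex M \<and> M \<noteq> {} \<and>
     (\<forall>x. support_fun M x = (support_fun K x powr p + support_fun L x powr p) powr (1 / p)))"

inductive lp_zonotope :: "real \<Rightarrow> 'a::euclidean_space set \<Rightarrow> bool" for p where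
  segment: "lp_zonotope p (closed_segment (- w) w)"
| sum: "lp_zonotope p Z \<Longrightarrow> lp_zonotope p (lp_sum p Z (closed_segment (- w) w))"

definition hausdorff_dist :: "'a::euclidean_space set \<Rightarrow> 'a set \<Rightarrow> real" where
  "hausdorff_dist K L = max (SUP x\<in>K. infdist x L) (SUP y\<in>L. infdist y K)"

definition lp_zonoid :: "real \<Rightarrow> 'a::euclidean_space set \<Rightarrow> bool" where
  "lp_zonoid p K \<longleftrightarrow> compact K \<and> K \<noteq> {} \<and>
     (\<exists>Z. (\<forall>k. lp_zonotope p (Z k)) \<and> (\<lambda>k. hausdorff_dist (Z k) K) \<longlonglongrightarrow> 0)"

definition radial_fun :: "'a::euclidean_space set \<Rightarrow> 'a \<Rightarrow> real" where
  "radial_fun K u = Sup {a. a *\<^sub>R u \<in> K}"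

text \<open>The projection onto the orthogonal complement of a unit vector.\<close>

definition proj_perp :: "'a::euclidean_space \<Rightarrow> 'a \<Rightarrow> 'a" where
  "proj_perp u x = x - (x \<bullet> u) *\<^sub>R u"

definition orthonormal_basis_of :: "'a::euclidean_space set \<Rightarrow> 'a set \<Rightarrow> bool" where
  "orthonormal_basis_of V B \<longleftrightarrow>
     pairwise orthogonal B \<and> (\<forall>b\<in>B. norm b = 1) \<and> span B = V"

text \<open>Lebesgue measure of a linear subspace \<open>V\<close>, of dimension \<open>dim V\<close>, built from an orthonormal
  basis of \<open>V\<close> just as \<^const>\<open>lborel\<close> is built from \<open>Basis\<close>. By rotation invariance
  the choice of the basis is immaterial. For \<open>V = {0}\<close> it is the unit mass at \<open>0\<close>.\<close>

definition subspace_lborel :: "'a::euclidean_space set \<Rightarrow> 'a measure" where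
  "subspace_lborel V = (let B = (SOME B. orthonormal_basis_of V B) in
     distr (\<Pi>\<^sub>M b\<in>B. lborel) borel (\<lambda>f. \<Sum>b\<in>B. f b *\<^sub>R b))"

definition perp_volume :: "'a::euclidean_space \<Rightarrow> 'a set \<Rightarrow> real" where
  "perp_volume u S = measure (subspace_lborel ({u}\<^sup>\<bottom>)) S"

definition supporting_hyperplane :: "'a::euclidean_space set \<Rightarrow> 'a \<Rightarrow> 'a set \<Rightarrow> bool" where
  "supporting_hyperplane K x H \<longleftrightarrow> x \<in> K \<and>
     (\<exists>v. v \<noteq> 0 \<and> H = {z. v \<bullet> z = v \<bullet> x} \<and> (\<forall>z\<in>K. v \<bullet> z \<le> v \<bullet> x))"

text \<open>A tangent hyperplane of a convex set is a supporting hyperplane at a point where there is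
  only one. If \<open>K\<close> spans a hyperplane, then that hyperplane is the tangent one at each relative
  interior point of \<open>K\<close>.\<close>

definition tangent_hyperplane :: "'a::euclidean_space set \<Rightarrow> 'a \<Rightarrow> 'a set \<Rightarrow> bool" where
  "tangent_hyperplane K x H \<longleftrightarrow> supporting_hyperplane K x H \<and>
     (\<forall>H'. supporting_hyperplane K x H' \<longrightarrow> H' = H)"

definition parallel_tangents_at ::
  "'a::euclidean_space set \<Rightarrow> 'a \<Rightarrow> 'a set \<Rightarrow> 'a \<Rightarrow> bool" where
  "parallel_tangents_at K x L y \<longleftrightarrow>
     (\<exists>H H'. tangent_hyperplane K x H \<and> tangent_hyperplane L y H' \<and> affine_parallel H H')"

text \<open>If the projection is a null set, the quotient is \<open>0 / 0\<close>, read as \<open>0\<close>.\<close>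

definition vol_ratio :: "'a::euclidean_space \<Rightarrow> 'a set \<Rightarrow> real" where
  "vol_ratio u K = measure lebesgue K / perp_volume u (proj_perp u ` K)"

end

theory Submission
  imports Defs
begin

text \<open>An \<open>L\<^sub>2\<close>-zonoid is an ellipsoid \<open>{y. \<forall>x. (x \<bullet> y)\<^sup>2 \<le> x \<bullet> M x}\<close> for a positive semidefinite \<open>M\<close>,
  and the \<open>\<ell>\<^sub>2\<close>-sum adds the operators. Let the form of \<open>M\<close> be positive definite on \<open>u\<^sup>\<bottom>\<close> and let
  \<open>w\<close> minimize it on the affine hyperplane \<open>{x. u \<bullet> x = 1}\<close>, with minimum \<open>s\<close>. Integrating along
  \<open>u\<close>, shifting each fibre by \<open>w \<bullet> y\<close> and rescaling it by \<open>sqrt s\<close>, shows that the volume of the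
  ellipsoid is \<open>c * sqrt s\<close> times the volume of its projection, where \<open>c\<close> depends on the dimension
  only. So the squared ratio is \<open>c\<^sup>2\<close> times a minimum of a form that is linear in \<open>M\<close>, hence
  superadditive in \<open>M\<close>, with equality iff both forms have the same minimizer \<open>w\<close>. The
  tangent hyperplane at the boundary point \<open>sqrt s *\<^sub>R u\<close> is orthogonal to \<open>w\<close>.\<close>

section \<open>Integration along a direction\<close>

text \<open>Both integrals are compared, by Fubini and translation invariance, with that of the
  indicator \<open>g\<close> of the unit ball, which \<open>T\<close> preserves.\<close>

lemma nn_integral_lborel_isometry:
  fixes T :: "'a::euclidean_space \<Rightarrow> 'a"
  assumes T: "linear T" "\<And>x. norm (T x) = norm x" and [measurable]: "f \<in> borel_measurable borel"
  shows "(\<integral>\<^sup>+x. f (T x) \<partial>lborel) = (\<integral>\<^sup>+x. f x \<partial>lborel)"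
proof -
  have [measurable]: "T \<in> borel_measurable borel"
    using T(1) by (intro borel_measurable_continuous_onI linear_continuous_on linear_conv_bounded_linear[THEN iffD1])
  have surj: "surj T"
    using T by (metis linear_injective_imp_surjective linear_injective_0 norm_eq_zero)
  define g :: "'a \<Rightarrow> ennreal" where "g = indicator (ball 0 1)"
  have [measurable]: "g \<in> borel_measurable borel" unfolding g_def by (rule borel_measurable_indicator) simp
  have gT: "g (T x) = g x" for x
    by (auto simp: g_def T indicator_def)
  have shift: "(\<integral>\<^sup>+x. h (c + x) \<partial>lborel) = (\<integral>\<^sup>+x. h x \<partial>lborel)"
    if [measurable]: "h \<in> borel_measurable borel" for h :: "'a \<Rightarrow> ennreal" and c
    by (subst (2) lborel_distr_plus[symmetric, of c]) (simp add: nn_integral_distr)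
  have refl: "(\<integral>\<^sup>+x. h (c - x) \<partial>lborel) = (\<integral>\<^sup>+x. h x \<partial>lborel)"
    if [measurable]: "h \<in> borel_measurable borel" for h :: "'a \<Rightarrow> ennreal" and c
    by (subst (2) lborel_affine[of "-1" c]) (simp_all add: nn_integral_density nn_integral_distr)
  have "(\<integral>\<^sup>+x. f (T x) \<partial>lborel) * (\<integral>\<^sup>+y. g y \<partial>lborel) = (\<integral>\<^sup>+x. f (T x) * (\<integral>\<^sup>+y. g y \<partial>lborel) \<partial>lborel)"
    by (simp add: nn_integral_multc)
  also have "\<dots> = (\<integral>\<^sup>+x. (\<integral>\<^sup>+y. f (T x) * g (T x + y) \<partial>lborel) \<partial>lborel)"
    by (simp add: nn_integral_cmult shift)
  also have "\<dots> = (\<integral>\<^sup>+y. (\<integral>\<^sup>+x. f (T x) * g (T x + y) \<partial>lborel) \<partial>lborel)"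
    by (rule lborel_pair.Fubini') measurable
  also have "\<dots> = (\<integral>\<^sup>+y. (\<integral>\<^sup>+x. f (T x - y) * g (T x) \<partial>lborel) \<partial>lborel)"
  proof (rule nn_integral_cong)
    fix y
    \<comment> \<open>The shift by \<open>y\<close> in the target of \<open>T\<close> becomes a
      shift of the integration variable by a preimage \<open>v\<close>.\<close>
    obtain v where v: "T v = y" using surj by (metis surjD)
    have "(\<integral>\<^sup>+x. f (T x) * g (T x + y) \<partial>lborel)
        = (\<integral>\<^sup>+x. f (T (- v + x)) * g (T (- v + x) + y) \<partial>lborel)"
      by (rule shift[symmetric]) measurable
    also have "\<dots> = (\<integral>\<^sup>+x. f (T x - y) * g (T x) \<partial>lborel)"
      using T(1) v by (simp add: linear_diff)
    finally show "(\<integral>\<^sup>+x. f (T x) * g (T x + y) \<partial>lborel) = (\<integral>\<^sup>+x. f (T x - y) * g (T x) \<partial>lborel)" .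
  qed
  also have "\<dots> = (\<integral>\<^sup>+x. (\<integral>\<^sup>+y. f (T x - y) * g (T x) \<partial>lborel) \<partial>lborel)"
    by (rule lborel_pair.Fubini') measurable
  also have "\<dots> = (\<integral>\<^sup>+x. f x \<partial>lborel) * (\<integral>\<^sup>+y. g y \<partial>lborel)"
    by (simp add: nn_integral_multc refl nn_integral_cmult gT)
  finally have *: "(\<integral>\<^sup>+x. f (T x) \<partial>lborel) * (\<integral>\<^sup>+y. g y \<partial>lborel)
     = (\<integral>\<^sup>+x. f x \<partial>lborel) * (\<integral>\<^sup>+y. g y \<partial>lborel)" .
  \<comment> \<open>Both sides of the identity carry the volume of the unit ball as a factor. It is
    positive and finite, so it can be cancelled in \<open>ennreal\<close>.\<close>
  have "(\<integral>\<^sup>+y. g y \<partial>lborel) = emeasure lborel (ball (0::'a) 1)"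
    by (simp add: g_def)
  moreover have "emeasure lborel (ball (0::'a) 1) \<noteq> \<infinity>"
    using emeasure_bounded_finite[OF bounded_ball] by (simp add: less_top)
  moreover have "emeasure lborel (ball (0::'a) 1) \<noteq> 0"
    using content_ball_pos[of 1 "0::'a"] by (auto simp: measure_def)
  ultimately show ?thesis
    using * by (metis ennreal_mult_cancel_left mult.commute infinity_ennreal_def)
qed

section \<open>Integration in orthonormal coordinates\<close>

lemma orthonormal_inner:
  assumes "pairwise orthogonal C" "\<And>c. c \<in> C \<Longrightarrow> norm c = 1" "b \<in> C" "c \<in> C"
  shows "b \<bullet> c = (if b = c then 1 else 0)"
  using assms by (auto simp: pairwise_def orthogonal_def norm_eq_1)

lemma orthonormal_finite:
  fixes C :: "'a::euclidean_space set"
  assumes "pairwise orthogonal C" "\<And>c. c \<in> C \<Longrightarrow> norm c = 1"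
  shows "independent C" "finite C"
proof -
  show "independent C"
    using assms by (intro pairwise_orthogonal_independent) (auto dest: assms(2)[of 0])
  then show "finite C" by (rule finiteI_independent)
qed

text \<open>It suffices to compare the two measures on boxes. The linear isometry \<open>T\<close>
  that carries \<open>Basis\<close> to \<open>C\<close> along a bijection \<open>p\<close> turns
  coordinates along \<open>C\<close> into standard coordinates, for which Lebesgue measure is a
  product.\<close>

lemma distr_lborel_orthonormal:
  fixes C :: "'a::euclidean_space set"
  assumes C: "pairwise orthogonal C" "\<And>c. c \<in> C \<Longrightarrow> norm c = 1" "span C = UNIV"
  shows "distr lborel (\<Pi>\<^sub>M c\<in>C. lborel) (\<lambda>x. \<lambda>c\<in>C. x \<bullet> c) = (\<Pi>\<^sub>M c\<in>C. (lborel :: real measure))"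
proof -
  note [simp] = orthonormal_finite[OF C(1,2)]
  interpret product_sigma_finite "\<lambda>_. lborel :: real measure" ..
  have "card C = card (Basis :: 'a set)"
    by (metis C(3) dim_UNIV dim_eq_card_independent dim_span orthonormal_finite(1)[OF C(1,2)])
  then obtain p where p: "bij_betw p (Basis :: 'a set) C"
    by (metis bij_betw_iff_card finite_Basis orthonormal_finite(2)[OF C(1,2)])
  define T where "T x = (\<Sum>b\<in>Basis. (x \<bullet> b) *\<^sub>R p b)" for x :: 'a
  have ip: "p a \<bullet> p b = (if a = b then 1 else 0)" if "a \<in> Basis" "b \<in> Basis" for a b
    using orthonormal_inner[OF C(1,2), of "p a" "p b"] p that
    by (auto simp: bij_betw_def inj_on_def)
  have T_inner: "T x \<bullet> p b = x \<bullet> b" if "b \<in> Basis" for x b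
    using that by (simp add: T_def inner_sum_left ip if_distrib cong: if_cong)
  have "T x \<bullet> T x = x \<bullet> x" for x
    by (subst (2) T_def) (simp add: inner_sum_right T_inner euclidean_inner[of x x])
  then have T_norm: "norm (T x) = norm x" for x
    by (simp add: norm_eq_sqrt_inner)
  have T_lin: "linear T"
    unfolding T_def by (intro linear_compose_sum ballI linear_scaleR_left) 
      (auto intro!: linearI simp: inner_add_left scaleR_add_left)
  show ?thesis
  proof (rule PiM_eqI)
    fix A :: "'a \<Rightarrow> real set" assume A: "\<And>c. c \<in> C \<Longrightarrow> A c \<in> sets lborel"
    then have [measurable]: "\<And>c. c \<in> C \<Longrightarrow> A c \<in> sets borel" by simp
    have "(\<lambda>x. \<lambda>c\<in>C. x \<bullet> c) -` (Pi\<^sub>E C A) = {x. \<forall>c\<in>C. x \<bullet> c \<in> A c}"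
      by auto
    moreover have mS[measurable]: "{x. \<forall>c\<in>C. x \<bullet> c \<in> A c} \<in> sets (borel :: 'a measure)"
    proof -
      have "Measurable.pred borel (\<lambda>x::'a. \<forall>c\<in>C. x \<bullet> c \<in> A c)" 
        by (intro pred_intros_finite(3)) auto
      then show ?thesis by (simp add: pred_def)
    qed
    ultimately have "emeasure (distr lborel (\<Pi>\<^sub>M c\<in>C. lborel) (\<lambda>x. \<lambda>c\<in>C. x \<bullet> c)) (Pi\<^sub>E C A)
      = (\<integral>\<^sup>+x. indicator {x. \<forall>c\<in>C. x \<bullet> c \<in> A c} x \<partial>lborel)"
      using A by (subst emeasure_distr) (auto intro!: sets_PiM_I_finite measurable_restrict)
    also have "\<dots> = (\<integral>\<^sup>+x. indicator {x. \<forall>c\<in>C. x \<bullet> c \<in> A c} (T x) \<partial>lborel)"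
      by (rule nn_integral_lborel_isometry[symmetric, OF T_lin T_norm]) measurable
    also have "\<dots> = (\<integral>\<^sup>+x. (\<Prod>b\<in>Basis. indicator (A (p b)) (x \<bullet> b)) \<partial>lborel)"
    proof (rule nn_integral_cong)
      fix x :: 'a
      have "(\<forall>c\<in>C. T x \<bullet> c \<in> A c) \<longleftrightarrow> (\<forall>b\<in>Basis. x \<bullet> b \<in> A (p b))"
        using p by (auto simp: bij_betw_def T_inner)
      then show "indicator {x. \<forall>c\<in>C. x \<bullet> c \<in> A c} (T x)
          = (\<Prod>b\<in>Basis. indicator (A (p b)) (x \<bullet> b) :: ennreal)"
        by (auto simp: indicator_def prod_zero_iff)
    qed
    also have "\<dots> = (\<Prod>b\<in>Basis. emeasure lborel (A (p b)))"
    proof -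
      have [measurable]: "b \<in> Basis \<Longrightarrow> A (p b) \<in> sets borel" for b
        using p A by (auto simp: bij_betw_def)
      show ?thesis by (subst nn_integral_lborel_prod) (auto intro!: prod.cong)
    qed
    also have "\<dots> = (\<Prod>c\<in>C. emeasure lborel (A c))"
      by (rule prod.reindex_bij_betw[OF p])
    finally show "emeasure (distr lborel (\<Pi>\<^sub>M c\<in>C. lborel) (\<lambda>x. \<lambda>c\<in>C. x \<bullet> c)) (Pi\<^sub>E C A)
      = (\<Prod>c\<in>C. emeasure lborel (A c))" .
  qed auto
qed

lemma nn_integral_lborel_orthonormal:
  fixes C :: "'a::euclidean_space set"
  assumes C: "pairwise orthogonal C" "\<And>c. c \<in> C \<Longrightarrow> norm c = 1" "span C = UNIV"
    and [measurable]: "f \<in> borel_measurable borel"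
  shows "(\<integral>\<^sup>+x. f x \<partial>lborel) = (\<integral>\<^sup>+h. f (\<Sum>c\<in>C. h c *\<^sub>R c) \<partial>(\<Pi>\<^sub>M c\<in>C. lborel))"
proof -
  have [measurable]: "(\<lambda>x::'a. \<lambda>c\<in>C. x \<bullet> c) \<in> measurable lborel (\<Pi>\<^sub>M c\<in>C. lborel)"
    by (intro measurable_restrict) simp
  have "(\<integral>\<^sup>+h. f (\<Sum>c\<in>C. h c *\<^sub>R c) \<partial>(\<Pi>\<^sub>M c\<in>C. lborel))
      = (\<integral>\<^sup>+h. f (\<Sum>c\<in>C. h c *\<^sub>R c)
          \<partial>distr lborel (\<Pi>\<^sub>M c\<in>C. lborel) (\<lambda>x. \<lambda>c\<in>C. x \<bullet> c))"
    by (simp only: distr_lborel_orthonormal[OF C])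
  also have "\<dots> = (\<integral>\<^sup>+x. f (\<Sum>c\<in>C. (\<lambda>c\<in>C. x \<bullet> c) c *\<^sub>R c) \<partial>lborel)"
    by (rule nn_integral_distr) measurable
  also have "\<dots> = (\<integral>\<^sup>+x. f x \<partial>lborel)"
    using orthonormal_basis_expand[OF C(1,2) _ orthonormal_finite(2)[OF C(1,2)]] C(3)
    by simp
  finally show ?thesis ..
qed

section \<open>Lebesgue measure on the orthogonal complement of \<open>u\<close>\<close>

abbreviation perp_lborel :: "'a::euclidean_space \<Rightarrow> 'a measure" where
  "perp_lborel u \<equiv> subspace_lborel ({u}\<^sup>\<bottom>)"

lemma mem_perp_iff [simp]: "y \<in> {u}\<^sup>\<bottom> \<longleftrightarrow> u \<bullet> y = 0"
  by (simp add: orthogonal_comp_def orthogonal_def)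

text \<open>Makes the basis behind \<open>SOME\<close> in \<open>subspace_lborel\<close> available.
  Every subspace has an orthonormal basis, so the chosen one has the prescribed properties.\<close>

lemma perp_lborel_decomp:
  fixes u :: "'a::euclidean_space"
  obtains B where "pairwise orthogonal B" "\<And>b. b \<in> B \<Longrightarrow> norm b = 1" "span B = {u}\<^sup>\<bottom>"
    "perp_lborel u = distr (\<Pi>\<^sub>M b\<in>B. lborel) borel (\<lambda>f. \<Sum>b\<in>B. f b *\<^sub>R b)"
proof -
  define B where "B = (SOME B. orthonormal_basis_of ({u}\<^sup>\<bottom>) B)"
  have "\<exists>B. orthonormal_basis_of ({u}\<^sup>\<bottom>) B"
    unfolding orthonormal_basis_of_def
    by (metis orthonormal_basis_subspace subspace_orthogonal_comp)
  then have "orthonormal_basis_of ({u}\<^sup>\<bottom>) B"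
    unfolding B_def by (rule someI_ex)
  then show thesis
    by (intro that[of B]) (auto simp: orthonormal_basis_of_def subspace_lborel_def Let_def B_def)
qed

lemma sets_perp_lborel [simp, measurable_cong]: "sets (perp_lborel u) = sets borel"
  by (simp add: subspace_lborel_def Let_def)

lemma space_perp_lborel [simp]: "space (perp_lborel u) = UNIV"
  by (simp add: subspace_lborel_def Let_def)

text \<open>The measure is defined on the whole space, but it is the image of a product measure
  under a map with values in the span of \<open>B\<close>. Integrands therefore only have to agree
  on \<open>u\<^sup>\<bottom>\<close>.\<close>

lemma AE_perp_lborel: "AE y in perp_lborel u. u \<bullet> y = 0"
proof -
  obtain B where B: "span B = {u}\<^sup>\<bottom>"
    "perp_lborel u = distr (\<Pi>\<^sub>M b\<in>B. lborel) borel (\<lambda>f. \<Sum>b\<in>B. f b *\<^sub>R b)"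
    by (rule perp_lborel_decomp)
  have "(\<Sum>b\<in>B. f b *\<^sub>R b) \<in> {u}\<^sup>\<bottom>" for f
    unfolding B(1)[symmetric] by (intro span_sum span_scale span_base)
  then show ?thesis
    unfolding B(2) by (subst AE_distr_iff) auto
qed

text \<open>Adjoining \<open>u\<close> to the orthonormal basis of \<open>u\<^sup>\<bottom>\<close>
  gives an orthonormal basis of the whole space, and the product measure lets the coordinate along
  \<open>u\<close> be split off as the inner or the outer integral. Together the two forms exchange
  integration over \<open>u\<^sup>\<bottom>\<close> and along \<open>u\<close>.\<close>

lemma nn_integral_perp_split:
  fixes u :: "'a::euclidean_space"
  assumes u: "norm u = 1" and [measurable]: "f \<in> borel_measurable borel"
  shows "(\<integral>\<^sup>+x. f x \<partial>lborel) = (\<integral>\<^sup>+y. (\<integral>\<^sup>+t. f (y + t *\<^sub>R u) \<partial>lborel) \<partial>perp_lborel u)"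
    and "(\<integral>\<^sup>+x. f x \<partial>lborel) = (\<integral>\<^sup>+t. (\<integral>\<^sup>+y. f (y + t *\<^sub>R u) \<partial>perp_lborel u) \<partial>lborel)"
proof -
  obtain B where B: "pairwise orthogonal B" "\<And>b. b \<in> B \<Longrightarrow> norm b = 1" "span B = {u}\<^sup>\<bottom>"
    "perp_lborel u = distr (\<Pi>\<^sub>M b\<in>B. lborel) borel (\<lambda>f. \<Sum>b\<in>B. f b *\<^sub>R b)"
    by (rule perp_lborel_decomp) blast
  interpret product_sigma_finite "\<lambda>_. lborel :: real measure" ..
  note fin[simp] = orthonormal_finite(2)[OF B(1,2)]
  have perpB: "u \<bullet> b = 0" if "b \<in> B" for b
    using span_base[OF that] B(3) by simp
  have [simp]: "u \<notin> B"
    using perpB[of u] u by auto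
  let ?C = "insert u B"
  have C: "pairwise orthogonal ?C" "\<And>c. c \<in> ?C \<Longrightarrow> norm c = 1"
    using B(1,2) u perpB by (auto simp: pairwise_insert orthogonal_def inner_commute)
  have "x \<in> span ?C" for x
  proof -
    have "x - (u \<bullet> x) *\<^sub>R u \<in> span B"
      using u unfolding B(3) by (simp add: inner_diff_right norm_eq_1)
    then show ?thesis
      by (auto simp: span_insert)
  qed
  then have C3: "span ?C = UNIV" by auto
  have [measurable]: "(\<lambda>h. f (\<Sum>c\<in>?C. h c *\<^sub>R c)) \<in> borel_measurable (\<Pi>\<^sub>M c\<in>?C. lborel)"
    by measurable
  have eq: "(\<Sum>c\<in>?C. (h(u := t)) c *\<^sub>R c) = (\<Sum>b\<in>B. h b *\<^sub>R b) + t *\<^sub>R u" for h t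
  proof -
    have "(\<Sum>b\<in>B. (h(u := t)) b *\<^sub>R b) = (\<Sum>b\<in>B. h b *\<^sub>R b)"
      using \<open>u \<notin> B\<close> by (intro sum.cong) auto
    then show ?thesis by (simp add: add.commute del: fun_upd_apply) (simp)
  qed
  let ?F = "\<lambda>h. f (\<Sum>c\<in>?C. h c *\<^sub>R c)" and ?s = "\<lambda>h. \<Sum>b\<in>B. h b *\<^sub>R b"
  have F: "(\<integral>\<^sup>+x. f x \<partial>lborel) = (\<integral>\<^sup>+h. ?F h \<partial>(\<Pi>\<^sub>M c\<in>?C. lborel))"
    by (rule nn_integral_lborel_orthonormal[OF C C3 assms(2)])
  have "(\<integral>\<^sup>+h. ?F h \<partial>(\<Pi>\<^sub>M c\<in>?C. lborel))
      = (\<integral>\<^sup>+h. (\<integral>\<^sup>+t. f (?s h + t *\<^sub>R u) \<partial>lborel) \<partial>(\<Pi>\<^sub>M b\<in>B. lborel))"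
    by (subst product_nn_integral_insert) (simp_all only: eq fin \<open>u \<notin> B\<close> not_False_eq_True, measurable)
  also have "\<dots> = (\<integral>\<^sup>+y. (\<integral>\<^sup>+t. f (y + t *\<^sub>R u) \<partial>lborel) \<partial>perp_lborel u)"
    unfolding B(4) by (rule nn_integral_distr[symmetric]) measurable
  finally show "(\<integral>\<^sup>+x. f x \<partial>lborel) = (\<integral>\<^sup>+y. (\<integral>\<^sup>+t. f (y + t *\<^sub>R u) \<partial>lborel) \<partial>perp_lborel u)"
    using F by simp
  have "(\<integral>\<^sup>+h. ?F h \<partial>(\<Pi>\<^sub>M c\<in>?C. lborel))
      = (\<integral>\<^sup>+t. (\<integral>\<^sup>+h. f (?s h + t *\<^sub>R u) \<partial>(\<Pi>\<^sub>M b\<in>B. lborel)) \<partial>lborel)"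
    by (subst product_nn_integral_insert_rev) (simp_all only: eq fin \<open>u \<notin> B\<close> not_False_eq_True, measurable)
  also have "\<dots> = (\<integral>\<^sup>+t. (\<integral>\<^sup>+y. f (y + t *\<^sub>R u) \<partial>perp_lborel u) \<partial>lborel)"
    unfolding B(4) by (intro nn_integral_cong nn_integral_distr[symmetric]) measurable
  finally show "(\<integral>\<^sup>+x. f x \<partial>lborel) = (\<integral>\<^sup>+t. (\<integral>\<^sup>+y. f (y + t *\<^sub>R u) \<partial>perp_lborel u) \<partial>lborel)"
    using F by simp
qed

section \<open>\<open>L\<^sub>2\<close>-zonoids are ellipsoids\<close>

text \<open>For \<open>c \<noteq> 0\<close> the polynomial is evaluated at its minimizer
  \<open>- b / c\<close>; for \<open>c = 0\<close> it is affine and bounded below, so its slope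
  vanishes.\<close>

lemma nonneg_quadratic_discriminant:
  fixes a b c :: real
  assumes "0 \<le> c" and nn: "\<And>t. 0 \<le> a + 2 * t * b + t\<^sup>2 * c"
  shows "b\<^sup>2 \<le> a * c"
proof (cases "c = 0")
  case True
  have "b = 0"
  proof (rule ccontr)
    assume "b \<noteq> 0"
    \<comment> \<open>At this \<open>t\<close> the affine function \<open>a + 2 * t * b\<close> has
      the value \<open>-1\<close>.\<close>
    then have "2 * (- (a + 1) / (2 * b)) * b = - (a + 1)" by simp
    then show False
      using nn[of "- (a + 1) / (2 * b)"] True by simp
  qed
  then show ?thesis using True by simp
next
  case False
  then have "0 \<le> a - b\<^sup>2 / c"
    using nn[of "- b / c"] by (simp add: field_simps power2_eq_square)
  then show ?thesis using False assms(1) by (simp add: field_simps)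
qed

section \<open>Ellipsoids of positive semidefinite operators\<close>

definition psd_op :: "('a::euclidean_space \<Rightarrow> 'a) \<Rightarrow> bool" where
  "psd_op M \<longleftrightarrow> linear M \<and> (\<forall>x y. x \<bullet> M y = y \<bullet> M x) \<and> (\<forall>x. 0 \<le> x \<bullet> M x)"

text \<open>For positive definite \<open>M\<close> this is the set of all y with y \<bullet> M^(-1)
  y \<le> 1. The form without an inverse also covers ellipsoids that lie in a proper
  subspace.\<close>

definition ellipsoid :: "('a::euclidean_space \<Rightarrow> 'a) \<Rightarrow> 'a set" where
  "ellipsoid M = {y. \<forall>x. (x \<bullet> y)\<^sup>2 \<le> x \<bullet> M x}"

lemma psd_op_linear: "psd_op M \<Longrightarrow> linear M"
  and psd_op_sym: "psd_op M \<Longrightarrow> x \<bullet> M y = y \<bullet> M x"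
  and psd_op_nonneg: "psd_op M \<Longrightarrow> 0 \<le> x \<bullet> M x"
  by (auto simp: psd_op_def)

lemma psd_op_add: "psd_op M \<Longrightarrow> psd_op M' \<Longrightarrow> psd_op (\<lambda>x. M x + M' x)"
  by (auto simp: psd_op_def inner_add_right intro: linear_compose_add add_mono)

lemma psd_op_expand:
  assumes "psd_op M"
  shows "(x + t *\<^sub>R y) \<bullet> M (x + t *\<^sub>R y) = x \<bullet> M x + 2 * t * (x \<bullet> M y) + t\<^sup>2 * (y \<bullet> M y)"
  using psd_op_linear[OF assms] psd_op_sym[OF assms, of y x]
  by (simp add: linear_add linear_scale inner_add_left inner_add_right power2_eq_square algebra_simps)

lemma psd_op_Cauchy_Schwarz:
  assumes "psd_op M"
  shows "(x \<bullet> M y)\<^sup>2 \<le> (x \<bullet> M x) * (y \<bullet> M y)"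
  by (rule nonneg_quadratic_discriminant)
    (simp_all only: psd_op_expand[OF assms, symmetric] psd_op_nonneg[OF assms])

text \<open>The one-sided bound for \<open>x\<close> and \<open>- x\<close> together bounds the
  absolute value, which can be squared. This presents the ellipsoid as an intersection of
  half-spaces.\<close>

lemma ellipsoid_iff_sqrt:
  assumes "psd_op M"
  shows "y \<in> ellipsoid M \<longleftrightarrow> (\<forall>x. x \<bullet> y \<le> sqrt (x \<bullet> M x))"
proof
  assume "y \<in> ellipsoid M"
  then show "\<forall>x. x \<bullet> y \<le> sqrt (x \<bullet> M x)"
    by (auto simp: ellipsoid_def intro: real_le_rsqrt)
next
  assume *: "\<forall>x. x \<bullet> y \<le> sqrt (x \<bullet> M x)"
  have "\<bar>x \<bullet> y\<bar> \<le> sqrt (x \<bullet> M x)" for x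
    using *[rule_format, of x] *[rule_format, of "- x"]
    by (simp add: linear_neg[OF psd_op_linear[OF assms]] abs_le_iff)
  then show "y \<in> ellipsoid M"
    unfolding ellipsoid_def using psd_op_nonneg[OF assms]
    by (auto dest!: power_mono[where n = 2] simp: power2_abs)
      (metis abs_ge_zero power2_abs power_mono real_sqrt_pow2)
qed

lemma ellipsoid_eq_INT:
  assumes "psd_op M"
  shows "ellipsoid M = (\<Inter>x. {y. x \<bullet> y \<le> sqrt (x \<bullet> M x)})"
  using ellipsoid_iff_sqrt[OF assms] by auto

lemma convex_ellipsoid: "psd_op M \<Longrightarrow> convex (ellipsoid M)"
  by (auto simp: ellipsoid_eq_INT intro: convex_INT convex_halfspace_le)

lemma closed_ellipsoid: "psd_op M \<Longrightarrow> closed (ellipsoid M)"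
  by (auto simp: ellipsoid_eq_INT intro: closed_INT closed_halfspace_le)

text \<open>The hypothesis on \<open>y\<close> is the membership condition for the single test
  vector \<open>x = y\<close>, so the bound applies to \<open>ellipsoid\<close> and to
  \<open>slice\<close> alike. With an operator bound \<open>L\<close> it says that the fourth power
  of the norm is at most \<open>L\<close> times its square.\<close>

lemma psd_op_bound:
  assumes "psd_op M"
  obtains K where "\<And>y. (y \<bullet> y)\<^sup>2 \<le> y \<bullet> M y \<Longrightarrow> norm y \<le> K"
proof -
  obtain L where L: "\<And>x. norm (M x) \<le> norm x * L"
    using bounded_linear.bounded[OF linear_conv_bounded_linear[THEN iffD1, OF psd_op_linear[OF assms]]]
    by blast
  show thesis
  proof (rule that)
    fix y assume "(y \<bullet> y)\<^sup>2 \<le> y \<bullet> M y"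
    also have "\<dots> \<le> norm y * norm (M y)" by (rule norm_cauchy_schwarz)
    also have "\<dots> \<le> norm y * (norm y * L)" by (rule mult_left_mono[OF L]) simp
    finally have *: "(norm y)\<^sup>2 * (norm y)\<^sup>2 \<le> (norm y)\<^sup>2 * L"
      by (simp add: dot_square_norm power2_eq_square mult.assoc)
    have "(norm y)\<^sup>2 \<le> \<bar>L\<bar>"
    proof (cases "y = 0")
      case False
      then have "(norm y)\<^sup>2 \<le> L"
        by (intro mult_left_le_imp_le[OF *]) simp
      then show ?thesis by simp
    qed simp
    then show "norm y \<le> sqrt \<bar>L\<bar>" by (rule real_le_rsqrt)
  qed
qed

lemma compact_ellipsoid:
  assumes "psd_op M"
  shows "compact (ellipsoid M)"
proof -
  obtain K where "\<And>y. (y \<bullet> y)\<^sup>2 \<le> y \<bullet> M y \<Longrightarrow> norm y \<le> K"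
    by (rule psd_op_bound[OF assms]) blast
  then have "bounded (ellipsoid M)"
    by (auto simp: ellipsoid_def bounded_iff)
  then show ?thesis
    by (simp add: compact_eq_bounded_closed closed_ellipsoid[OF assms])
qed

lemma zero_mem_ellipsoid: "psd_op M \<Longrightarrow> 0 \<in> ellipsoid M"
  by (auto simp: ellipsoid_def psd_op_nonneg)

text \<open>The witness is the gradient of \<open>sqrt (x \<bullet> M x)\<close> at
  \<open>x\<close>, which lies in the ellipsoid by Cauchy-Schwarz. Where the form vanishes, the
  origin attains the value.\<close>

lemma ellipsoid_support_attained:
  assumes "psd_op M"
  obtains y where "y \<in> ellipsoid M" "x \<bullet> y = sqrt (x \<bullet> M x)"
proof (cases "x \<bullet> M x = 0")
  case True
  then show ?thesis using that[of 0] zero_mem_ellipsoid[OF assms] by simp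
next
  case False
  with psd_op_nonneg[OF assms, of x] have pos: "x \<bullet> M x > 0" by simp
  show ?thesis
  proof (rule that)
    show "M x /\<^sub>R sqrt (x \<bullet> M x) \<in> ellipsoid M"
      using psd_op_Cauchy_Schwarz[OF assms, of _ x] pos
      by (auto simp: ellipsoid_def power_divide field_simps)
    show "x \<bullet> (M x /\<^sub>R sqrt (x \<bullet> M x)) = sqrt (x \<bullet> M x)"
      using pos by (simp add: field_simps)
  qed
qed

lemma support_fun_ellipsoid:
  assumes "psd_op M"
  shows "support_fun (ellipsoid M) x = sqrt (x \<bullet> M x)"
proof -
  obtain y where "y \<in> ellipsoid M" "x \<bullet> y = sqrt (x \<bullet> M x)"
    by (rule ellipsoid_support_attained[OF assms])
  then show ?thesis
    unfolding support_fun_def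
    by (intro cSup_eq_maximum) (auto simp: ellipsoid_iff_sqrt[OF assms] intro!: image_eqI[of _ _ y])
qed

section \<open>Support functions, sums and zonotopes\<close>

lemma bdd_above_inner: "compact K \<Longrightarrow> bdd_above ((\<lambda>y. x \<bullet> y) ` K)"
  for K :: "'a::euclidean_space set"
  by (intro bounded_imp_bdd_above compact_imp_bounded compact_continuous_image continuous_intros)

lemma inner_le_support_fun: "compact K \<Longrightarrow> y \<in> K \<Longrightarrow> x \<bullet> y \<le> support_fun K x"
  unfolding support_fun_def by (intro cSUP_upper bdd_above_inner)

lemma mem_iff_le_support_fun:
  fixes K :: "'a::euclidean_space set"
  assumes "compact K" "convex K" "K \<noteq> {}"
  shows "y \<in> K \<longleftrightarrow> (\<forall>x. x \<bullet> y \<le> support_fun K x)"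
proof
  assume *: "\<forall>x. x \<bullet> y \<le> support_fun K x"
  show "y \<in> K"
  proof (rule ccontr)
    assume "y \<notin> K"
    then obtain a b where ab: "a \<bullet> y < b" "\<forall>z\<in>K. a \<bullet> z > b"
      using separating_hyperplane_closed_point[OF assms(2) compact_imp_closed[OF assms(1)]] by blast
    \<comment> \<open>The separating functional \<open>a\<close> bounds \<open>K\<close> from below,
      hence the change of sign.\<close>
    have "support_fun K (- a) \<le> - b"
      unfolding support_fun_def using ab(2) assms(3) by (intro cSUP_least) (auto intro: less_imp_le)
    with *[rule_format, of "- a"] ab(1) show False by simp
  qed
qed (use assms inner_le_support_fun in blast)

lemma eq_ellipsoidI:
  assumes M: "psd_op M" and K: "compact K" "convex K" "K \<noteq> {}"
    and "\<And>x. support_fun K x = sqrt (x \<bullet> M x)"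
  shows "K = ellipsoid M"
  using mem_iff_le_support_fun[OF K] ellipsoid_iff_sqrt[OF M] assms(5) by auto

text \<open>The squared support function of an ellipsoid is its quadratic form, so for
  \<open>p = 2\<close> the defining condition adds the two forms. A compact convex set is determined
  by its support function, which settles the uniqueness that \<open>THE\<close> asks for.\<close>

lemma lp_sum_ellipsoid:
  assumes M: "psd_op M" "psd_op M'"
  shows "lp_sum 2 (ellipsoid M) (ellipsoid M') = ellipsoid (\<lambda>x. M x + M' x)"
proof -
  note MM = psd_op_add[OF M]
  have h: "(support_fun (ellipsoid M) x powr 2 + support_fun (ellipsoid M') x powr 2) powr (1 / 2)
      = sqrt (x \<bullet> (M x + M' x))" for x
    using psd_op_nonneg[OF M(1), of x] psd_op_nonneg[OF M(2), of x]
    by (simp add: support_fun_ellipsoid M inner_add_right powr_half_sqrt)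
  show ?thesis
    unfolding lp_sum_def h
  proof (rule the_equality)
    show "compact (ellipsoid (\<lambda>x. M x + M' x)) \<and> convex (ellipsoid (\<lambda>x. M x + M' x)) \<and>
        ellipsoid (\<lambda>x. M x + M' x) \<noteq> {} \<and>
        (\<forall>x. support_fun (ellipsoid (\<lambda>x. M x + M' x)) x = sqrt (x \<bullet> (M x + M' x)))"
      using compact_ellipsoid[OF MM] convex_ellipsoid[OF MM] zero_mem_ellipsoid[OF MM]
        support_fun_ellipsoid[OF MM] by auto
  qed (use eq_ellipsoidI[OF MM] in blast)
qed

text \<open>The segment from \<open>- w\<close> to \<open>w\<close> has support function
  \<open>\<bar>x \<bullet> w\<bar>\<close>. Its square is the form of the rank-one operator
  \<open>\<lambda>x. (x \<bullet> w) *\<^sub>R w\<close>, and sums add operators.\<close>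

lemma lp_zonotope_2_ellipsoid:
  assumes "lp_zonotope 2 Z"
  obtains M where "psd_op M" "Z = ellipsoid M"
proof -
  have seg: "psd_op (\<lambda>x. (x \<bullet> w) *\<^sub>R w) \<and> closed_segment (- w) w = ellipsoid (\<lambda>x. (x \<bullet> w) *\<^sub>R w)"
    for w :: 'a
  proof
    show *: "psd_op (\<lambda>x. (x \<bullet> w) *\<^sub>R w)"
      by (auto simp: psd_op_def inner_add_left scaleR_add_left intro!: linearI)
    show "closed_segment (- w) w = ellipsoid (\<lambda>x. (x \<bullet> w) *\<^sub>R w)"
    proof (rule eq_ellipsoidI[OF *])
      fix x
      have "x \<bullet> y \<le> \<bar>x \<bullet> w\<bar>" if y: "y \<in> closed_segment (- w) w" for y
      proof -
        obtain t where t: "0 \<le> t" "t \<le> 1" "y = t *\<^sub>R w - (1 - t) *\<^sub>R w"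
          using y by (auto simp: closed_segment_def)
        have "x \<bullet> y = (2 * t - 1) * (x \<bullet> w)"
          unfolding t(3) inner_diff_right inner_scaleR_right by (simp add: algebra_simps)
        also have "\<dots> \<le> \<bar>2 * t - 1\<bar> * \<bar>x \<bullet> w\<bar>" by (metis abs_ge_self abs_mult)
        also have "\<dots> \<le> 1 * \<bar>x \<bullet> w\<bar>" using t by (intro mult_right_mono) auto
        finally show ?thesis by simp
      qed
      moreover have "\<bar>x \<bullet> w\<bar> \<in> (\<lambda>y. x \<bullet> y) ` closed_segment (- w) w"
      proof (cases "0 \<le> x \<bullet> w")
        case True
        then show ?thesis by (intro image_eqI[where x = w]) simp_all
      next
        case False
        then show ?thesis by (intro image_eqI[where x = "- w"]) simp_all
      qed
      ultimately have "support_fun (closed_segment (- w) w) x = \<bar>x \<bullet> w\<bar>"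
        unfolding support_fun_def by (intro cSup_eq_maximum) blast+
      then show "support_fun (closed_segment (- w) w) x = sqrt (x \<bullet> (x \<bullet> w) *\<^sub>R w)"
        by simp
    qed auto
  qed
  from assms have "\<exists>M. psd_op M \<and> Z = ellipsoid M"
  proof induction
    case (segment w)
    then show ?case using seg by blast
  next
    case (sum Z w)
    then show ?case using seg lp_sum_ellipsoid psd_op_add by metis
  qed
  then show thesis using that by blast
qed

section \<open>Passage to Hausdorff limits\<close>

lemma hausdorff_dist_near:
  fixes K L :: "'a::euclidean_space set"
  assumes "compact K" "compact L" "L \<noteq> {}" "x \<in> K"
  obtains y where "y \<in> L" "dist x y \<le> hausdorff_dist K L"
proof -
  obtain y where y: "y \<in> L" "infdist x L = dist x y"
    using infdist_attains_inf[OF compact_imp_closed] assms by metis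
  have "bdd_above ((\<lambda>x. infdist x L) ` K)"
    by (intro bounded_imp_bdd_above compact_imp_bounded compact_continuous_image continuous_intros assms)
  then have "infdist x L \<le> hausdorff_dist K L"
    unfolding hausdorff_dist_def using assms(4) by (intro max.coboundedI1 cSUP_upper)
  then show thesis using y that by auto
qed

lemma hausdorff_dist_commute: "hausdorff_dist K L = hausdorff_dist L K"
  by (simp add: hausdorff_dist_def max.commute)

text \<open>Each point of one set has a point of the other within the Hausdorff distance, and
  replacing the former by the latter changes the inner product with \<open>x\<close> by at most
  \<open>norm x\<close> times that distance.\<close>

lemma support_fun_hausdorff:
  fixes K L :: "'a::euclidean_space set"
  assumes "compact K" "compact L" "K \<noteq> {}" "L \<noteq> {}"
  shows "\<bar>support_fun K x - support_fun L x\<bar> \<le> norm x * hausdorff_dist K L"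
proof -
  have *: "support_fun K x \<le> support_fun L x + norm x * hausdorff_dist K L"
    if KL: "compact K" "compact L" "K \<noteq> {}" "L \<noteq> {}" for K L :: "'a set"
  proof (subst support_fun_def, rule cSUP_least[OF KL(3)])
    fix y assume "y \<in> K"
    then obtain z where z: "z \<in> L" "dist y z \<le> hausdorff_dist K L"
      using hausdorff_dist_near KL by blast
    have "x \<bullet> y = x \<bullet> z + x \<bullet> (y - z)" by (simp add: inner_diff_right)
    also have "x \<bullet> z \<le> support_fun L x" by (rule inner_le_support_fun[OF KL(2) z(1)])
    also have "x \<bullet> (y - z) \<le> norm x * norm (y - z)" by (rule norm_cauchy_schwarz)
    also have "\<dots> \<le> norm x * hausdorff_dist K L" 
      using z(2) by (intro mult_left_mono) (auto simp: dist_norm)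
    finally show "x \<bullet> y \<le> support_fun L x + norm x * hausdorff_dist K L" by simp
  qed
  show ?thesis
    using *[OF assms] *[OF assms(2,1,4,3)] by (simp add: hausdorff_dist_commute[of L K] abs_le_iff)
qed

text \<open>\<open>lp_zonoid\<close> demands only compactness of \<open>K\<close>, while recovering
  \<open>K\<close> from its support function requires convexity. Two points of \<open>K\<close> are
  moved into \<open>Z k\<close>, combined there, and the combination is moved back to
  \<open>K\<close>; the total error is at most twice the distance.\<close>

lemma convex_hausdorff_limit:
  fixes K :: "'a::euclidean_space set"
  assumes K: "compact K" "K \<noteq> {}"
    and Z: "\<And>k. compact (Z k)" "\<And>k. convex (Z k)" "\<And>k. Z k \<noteq> {}"
    and lim: "(\<lambda>k. hausdorff_dist (Z k) K) \<longlonglongrightarrow> 0"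
  shows "convex K"
proof (rule convexI)
  fix x y :: 'a and s t :: real
  assume xy: "x \<in> K" "y \<in> K" and st: "0 \<le> s" "0 \<le> t" "s + t = 1"
  let ?p = "s *\<^sub>R x + t *\<^sub>R y"
  have "infdist ?p K \<le> 2 * hausdorff_dist (Z k) K" for k
  proof -
    obtain x' y' where x': "x' \<in> Z k" "dist x x' \<le> hausdorff_dist (Z k) K"
      and y': "y' \<in> Z k" "dist y y' \<le> hausdorff_dist (Z k) K"
      using hausdorff_dist_near[OF K(1) Z(1) Z(3)] xy hausdorff_dist_commute by metis
    let ?q = "s *\<^sub>R x' + t *\<^sub>R y'"
    have "?q \<in> Z k" using Z(2) x' y' st by (auto simp: convex_def)
    then obtain r where r: "r \<in> K" "dist ?q r \<le> hausdorff_dist (Z k) K"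
      using hausdorff_dist_near[OF Z(1) K] by metis
    have "?p - ?q = s *\<^sub>R (x - x') + t *\<^sub>R (y - y')"
      by (simp add: algebra_simps)
    then have "dist ?p ?q \<le> s * dist x x' + t * dist y y'"
      using norm_triangle_ineq[of "s *\<^sub>R (x - x')" "t *\<^sub>R (y - y')"] st by (simp add: dist_norm)
    also have "\<dots> \<le> s * hausdorff_dist (Z k) K + t * hausdorff_dist (Z k) K"
      using st x' y' by (intro add_mono mult_left_mono)
    also have "\<dots> = hausdorff_dist (Z k) K"
      using st by (simp flip: distrib_right)
    finally have "dist ?p r \<le> 2 * hausdorff_dist (Z k) K"
      using r(2) dist_triangle[of ?p r ?q] by simp
    then show ?thesis using infdist_le[OF r(1), of ?p] by simp
  qed
  moreover have "(\<lambda>k. 2 * hausdorff_dist (Z k) K) \<longlonglongrightarrow> 0"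
    using tendsto_mult_left[OF lim, of 2] by simp
  ultimately have "infdist ?p K \<le> 0"
    by (meson LIMSEQ_le_const)
  then have "infdist ?p K = 0" using infdist_nonneg[of ?p K] by simp
  then show "?p \<in> K"
    using in_closed_iff_infdist_zero[OF compact_imp_closed[OF K(1)] K(2)] by simp
qed

text \<open>By polarization, a pointwise limit of squared support functions of ellipsoids is again
  a quadratic form.\<close>

lemma lp_zonoid_2_ellipsoid:
  fixes K :: "'a::euclidean_space set"
  assumes "lp_zonoid 2 K"
  obtains M where "psd_op M" "K = ellipsoid M"
proof -
  obtain Z where K: "compact K" "K \<noteq> {}" and Z: "\<And>k. lp_zonotope 2 (Z k)"
    and lim: "(\<lambda>k. hausdorff_dist (Z k) K) \<longlonglongrightarrow> 0"
    using assms unfolding lp_zonoid_def by blast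
  have "\<forall>k. \<exists>M. psd_op M \<and> Z k = ellipsoid M"
    using lp_zonotope_2_ellipsoid[OF Z] by metis
  then obtain N where N: "\<And>k. psd_op (N k)" "\<And>k. Z k = ellipsoid (N k)"
    by metis
  have Zk: "compact (Z k)" "convex (Z k)" "Z k \<noteq> {}" for k
    unfolding N(2) using compact_ellipsoid[OF N(1)] convex_ellipsoid[OF N(1)] zero_mem_ellipsoid[OF N(1)]
    by blast+
  let ?h = "support_fun K"
  have "(\<lambda>k. sqrt (x \<bullet> N k x)) \<longlonglongrightarrow> ?h x" for x
  proof (rule LIM_zero_cancel, rule Lim_null_comparison)
    show "\<forall>\<^sub>F k in sequentially. norm (sqrt (x \<bullet> N k x) - ?h x) \<le> norm x * hausdorff_dist (Z k) K"
      using support_fun_hausdorff[OF Zk(1) K(1) Zk(3) K(2)]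
      by (simp add: N(2) support_fun_ellipsoid[OF N(1)])
    show "(\<lambda>k. norm x * hausdorff_dist (Z k) K) \<longlonglongrightarrow> 0"
      using tendsto_mult_left[OF lim, of "norm x"] by simp
  qed
  then have q: "(\<lambda>k. x \<bullet> N k x) \<longlonglongrightarrow> (?h x)\<^sup>2" and h_nonneg: "0 \<le> ?h x" for x
    using tendsto_power[of "\<lambda>k. sqrt (x \<bullet> N k x)" "?h x" sequentially 2]
      tendsto_lowerbound[of "\<lambda>k. sqrt (x \<bullet> N k x)" "?h x" sequentially 0]
    by (simp_all add: psd_op_nonneg[OF N(1)])
  have polar: "x \<bullet> N k y = ((x + y) \<bullet> N k (x + y) - x \<bullet> N k x - y \<bullet> N k y) / 2" for x y k
    using psd_op_expand[OF N(1)[of k], of x 1 y] by simp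
  have "(\<lambda>k. ((x + y) \<bullet> N k (x + y) - x \<bullet> N k x - y \<bullet> N k y) / 2)
      \<longlonglongrightarrow> ((?h (x + y))\<^sup>2 - (?h x)\<^sup>2 - (?h y)\<^sup>2) / 2" for x y
    by (intro tendsto_divide tendsto_diff q tendsto_const) simp
  then have "convergent (\<lambda>k. x \<bullet> N k y)" for x y
    unfolding polar[symmetric] by (rule convergentI)
  then have conv: "(\<lambda>k. x \<bullet> N k y) \<longlonglongrightarrow> lim (\<lambda>k. x \<bullet> N k y)" for x y
    by (simp add: convergent_LIMSEQ_iff)
  \<comment> \<open>The limits of the coordinates of \<open>N k y\<close> are assembled to a vector,
    so that \<open>N k\<close> converges to \<open>M\<close> pointwise. Linearity and symmetry then
    pass to the limit.\<close>
  define M where "M y = (\<Sum>b\<in>Basis. lim (\<lambda>k. b \<bullet> N k y) *\<^sub>R b)" for y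
  have "(\<lambda>k. \<Sum>b\<in>Basis. (b \<bullet> N k y) *\<^sub>R b) \<longlonglongrightarrow> M y" for y
    unfolding M_def by (intro tendsto_intros conv)
  then have M: "(\<lambda>k. N k y) \<longlonglongrightarrow> M y" for y
    by (simp add: inner_commute[of _ "N _ _"] euclidean_representation)
  have M_q: "x \<bullet> M x = (?h x)\<^sup>2" for x
    by (rule LIMSEQ_unique[OF _ q]) (intro tendsto_intros M)
  have "psd_op M"
    unfolding psd_op_def
  proof (intro conjI allI)
    show "linear M"
    proof (rule linearI)
      fix x y and c :: real
      show "M (x + y) = M x + M y"
        using tendsto_add[OF M[of x] M[of y]]
        by (intro LIMSEQ_unique[OF M]) (simp add: linear_add[OF psd_op_linear[OF N(1)]])
      show "M (c *\<^sub>R x) = c *\<^sub>R M x"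
        using tendsto_scaleR[OF tendsto_const[of c] M[of x]]
        by (intro LIMSEQ_unique[OF M]) (simp add: linear_scale[OF psd_op_linear[OF N(1)]])
    qed
    show "x \<bullet> M y = y \<bullet> M x" for x y
      using tendsto_inner[OF tendsto_const[of x] M[of y]] tendsto_inner[OF tendsto_const[of y] M[of x]]
      by (intro LIMSEQ_unique) (simp_all add: psd_op_sym[OF N(1), where x = x and y = y])
    show "0 \<le> x \<bullet> M x" for x
      by (simp add: M_q)
  qed
  moreover have "K = ellipsoid M"
    using calculation K convex_hausdorff_limit[OF K Zk lim]
    by (intro eq_ellipsoidI) (simp_all add: M_q h_nonneg)
  ultimately show thesis by (rule that)
qed

section \<open>Fibres and projections of ellipsoids\<close>

text \<open>For \<open>r > 0\<close> this is the dilate by \<open>sqrt r\<close> of the ellipsoid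
  that the restricted form defines inside \<open>u\<^sup>\<bottom>\<close>. The value
  \<open>r = 1\<close> will give the projection of \<open>ellipsoid M\<close>, and other values
  describe its fibres along \<open>u\<close>.\<close>

definition slice :: "'a::euclidean_space \<Rightarrow> ('a \<Rightarrow> 'a) \<Rightarrow> real \<Rightarrow> 'a set" where
  "slice u M r = {y. u \<bullet> y = 0 \<and> (\<forall>z. u \<bullet> z = 0 \<longrightarrow> (z \<bullet> y)\<^sup>2 \<le> r * (z \<bullet> M z))}"

definition cylinder :: "'a::euclidean_space \<Rightarrow> 'a set \<Rightarrow> real \<Rightarrow> 'a set" where
  "cylinder u S h = {x. proj_perp u x \<in> S \<and> 0 \<le> u \<bullet> x \<and> u \<bullet> x \<le> h}"

text \<open>The condition that distinguishes slices of positive measure from null slices, see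
  \<open>slice_pos_finite\<close> and \<open>slice_degenerate_null\<close>.\<close>

definition pos_def_perp :: "'a::euclidean_space \<Rightarrow> ('a \<Rightarrow> 'a) \<Rightarrow> bool" where
  "pos_def_perp u M \<longleftrightarrow> (\<forall>z. u \<bullet> z = 0 \<longrightarrow> z \<noteq> 0 \<longrightarrow> 0 < z \<bullet> M z)"

lemma closed_slice: "closed (slice u M r)"
proof -
  have "slice u M r = {y. u \<bullet> y = 0} \<inter> (\<Inter>z\<in>{z. u \<bullet> z = 0}. {y. (z \<bullet> y)\<^sup>2 \<le> r * (z \<bullet> M z)})"
    by (auto simp: slice_def)
  also have "closed \<dots>"
    by (intro closed_Int closed_INT ballI closed_Collect_eq closed_Collect_le continuous_intros)
  finally show ?thesis .
qed

lemma proj_perp_continuous: "continuous_on A (proj_perp u)"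
  unfolding proj_perp_def by (intro continuous_intros)

lemma proj_perp_measurable [measurable]: "proj_perp u \<in> borel_measurable borel"
  by (intro borel_measurable_continuous_onI proj_perp_continuous)

lemma cylinder_borel [measurable]:
  assumes [measurable]: "S \<in> sets borel"
  shows "cylinder u S h \<in> sets borel"
  unfolding cylinder_def by measurable

lemma inner_proj_perp: "u \<bullet> z = 0 \<Longrightarrow> z \<bullet> proj_perp u x = z \<bullet> x"
  by (simp add: proj_perp_def inner_diff_right inner_commute)

lemma perp_proj_perp: "norm u = 1 \<Longrightarrow> u \<bullet> proj_perp u x = 0"
  by (simp add: proj_perp_def inner_diff_right inner_commute norm_eq_1)

text \<open>Volume of a right cylinder as height times base. It transfers scaling, null sets and
  boundedness from Lebesgue measure on the whole space to the measure on
  \<open>u\<^sup>\<bottom>\<close>.\<close>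

lemma emeasure_cylinder:
  fixes u :: "'a::euclidean_space"
  assumes u: "norm u = 1" and h: "0 \<le> h" and S[measurable]: "S \<in> sets borel"
  shows "emeasure lborel (cylinder u S h) = ennreal h * emeasure (perp_lborel u) S"
proof -
  have "emeasure lborel (cylinder u S h) = (\<integral>\<^sup>+x. indicator (cylinder u S h) x \<partial>lborel)"
    by simp
  also have "\<dots> = (\<integral>\<^sup>+t. (\<integral>\<^sup>+y. indicator (cylinder u S h) (y + t *\<^sub>R u) \<partial>perp_lborel u) \<partial>lborel)"
    by (rule nn_integral_perp_split(2)[OF u]) measurable
  also have "\<dots> = (\<integral>\<^sup>+t. (\<integral>\<^sup>+y. indicator {0..h} t * indicator S y \<partial>perp_lborel u) \<partial>lborel)"
  proof (rule nn_integral_cong, rule nn_integral_cong_AE)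
    fix t
    show "AE y in perp_lborel u. indicator (cylinder u S h) (y + t *\<^sub>R u)
        = (indicator {0..h} t * indicator S y :: ennreal)"
      using AE_perp_lborel
    proof eventually_elim
      fix y assume "u \<bullet> y = 0"
      then have "proj_perp u (y + t *\<^sub>R u) = y" "u \<bullet> (y + t *\<^sub>R u) = t"
        using u by (simp_all add: proj_perp_def inner_add_left inner_add_right norm_eq_1 inner_commute)
      then show "indicator (cylinder u S h) (y + t *\<^sub>R u) = (indicator {0..h} t * indicator S y :: ennreal)"
        by (auto simp: cylinder_def indicator_def)
    qed
  qed
  also have "\<dots> = ennreal h * emeasure (perp_lborel u) S"
    using h by (simp add: nn_integral_cmult nn_integral_multc)
  finally show ?thesis .
qed

section \<open>Scaling, nullity and finiteness of slices\<close>

lemma slice_scale: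
  assumes "0 < r"
  shows "r *\<^sub>R y \<in> slice u M (r\<^sup>2 * c) \<longleftrightarrow> y \<in> slice u M c"
  using assms by (simp add: slice_def power_mult_distrib mult.assoc)

text \<open>Dilating the cylinder over the unit slice by \<open>r\<close> multiplies its volume by
  the power of \<open>r\<close> to the full dimension. The height accounts for one factor
  \<open>r\<close>, so the base scales by one power less.\<close>

lemma emeasure_slice_scale:
  fixes u :: "'a::euclidean_space"
  assumes u: "norm u = 1" and r: "0 < r"
  shows "emeasure (perp_lborel u) (slice u M (r\<^sup>2))
    = ennreal (r ^ DIM('a) / r) * emeasure (perp_lborel u) (slice u M 1)"
proof -
  have [measurable]: "slice u M c \<in> sets borel" for c
    by (rule borel_closed[OF closed_slice])
  have mem: "r *\<^sub>R x \<in> cylinder u (slice u M (r\<^sup>2)) r \<longleftrightarrow> x \<in> cylinder u (slice u M 1) 1" for x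
  proof -
    have "proj_perp u (r *\<^sub>R x) = r *\<^sub>R proj_perp u x"
      by (simp add: proj_perp_def scaleR_diff_right)
    then show ?thesis
      using r slice_scale[OF r, of "proj_perp u x" u M 1]
      by (simp add: cylinder_def zero_le_mult_iff)
  qed
  let ?E = "\<lambda>c. emeasure (perp_lborel u) (slice u M c)"
  have "ennreal r * ?E (r\<^sup>2) = emeasure lborel (cylinder u (slice u M (r\<^sup>2)) r)"
    using r by (subst emeasure_cylinder[OF u]) auto
  also have "\<dots> = ennreal (r ^ DIM('a)) * emeasure lborel (cylinder u (slice u M 1) 1)"
  proof -
    have "(*\<^sub>R) r -` cylinder u (slice u M (r\<^sup>2)) r = cylinder u (slice u M 1) 1"
      by (auto simp: mem)
    then show ?thesis
      using r by (subst lborel_affine[of r 0])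
        (simp_all add: emeasure_density nn_integral_cmult emeasure_distr)
  qed
  also have "\<dots> = ennreal (r ^ DIM('a)) * ?E 1"
    by (subst emeasure_cylinder[OF u]) auto
  finally have *: "ennreal r * ?E (r\<^sup>2) = ennreal (r ^ DIM('a)) * ?E 1" .
  have "?E (r\<^sup>2) = ennreal (1 / r) * (ennreal r * ?E (r\<^sup>2))"
    using r by (simp add: mult.assoc[symmetric] ennreal_mult[symmetric])
  also have "\<dots> = ennreal (r ^ DIM('a) / r) * ?E 1"
    unfolding * using r by (simp add: mult.assoc[symmetric] ennreal_mult[symmetric])
  finally show ?thesis .
qed

text \<open>A nonzero \<open>z\<close> in \<open>u\<^sup>\<bottom>\<close> on which the form
  vanishes is orthogonal to the whole slice, so the cylinder over the slice lies in a
  hyperplane.\<close>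

lemma slice_degenerate_null:
  fixes u :: "'a::euclidean_space"
  assumes u: "norm u = 1" and "psd_op M" "\<not> pos_def_perp u M"
  shows "emeasure (perp_lborel u) (slice u M 1) = 0"
proof -
  obtain z where z: "u \<bullet> z = 0" "z \<noteq> 0" "z \<bullet> M z = 0"
    using assms psd_op_nonneg[OF assms(2)] unfolding pos_def_perp_def by (metis less_eq_real_def)
  have "cylinder u (slice u M 1) 1 \<subseteq> {x. z \<bullet> x = 0}"
    using z by (auto simp: cylinder_def slice_def inner_proj_perp)
  moreover have "negligible {x. z \<bullet> x = 0}"
    using z by (intro negligible_hyperplane) auto
  ultimately have "negligible (cylinder u (slice u M 1) 1)"
    by (rule negligible_subset[rotated])
  then have "emeasure lborel (cylinder u (slice u M 1) 1) = 0"
    by (simp add: negligible_iff_emeasure0 borel_closed closed_slice)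
  then show ?thesis
    using emeasure_cylinder[OF u, of 1 "slice u M 1"] by (simp add: borel_closed closed_slice)
qed

text \<open>By compactness the form attains a positive minimum on the unit sphere of
  \<open>u\<^sup>\<bottom>\<close>, and homogeneity does the rest. If that sphere is empty,
  \<open>u\<^sup>\<bottom>\<close> contains only \<open>0\<close> and the constant \<open>1\<close>
  serves.\<close>

lemma pos_def_perp_coercive:
  fixes u :: "'a::euclidean_space"
  assumes M: "psd_op M" and pd: "pos_def_perp u M"
  obtains d where "0 < d" "\<And>z. u \<bullet> z = 0 \<Longrightarrow> d * (norm z)\<^sup>2 \<le> z \<bullet> M z"
proof (cases "{z. u \<bullet> z = 0} \<inter> sphere 0 1 = {}")
  case True
  have "z = 0" if "u \<bullet> z = 0" for z
  proof (rule ccontr)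
    assume "z \<noteq> 0"
    then have "z /\<^sub>R norm z \<in> {z. u \<bullet> z = 0} \<inter> sphere 0 1" using that by simp
    with True show False by blast
  qed
  then have "1 * (norm z)\<^sup>2 \<le> z \<bullet> M z" if "u \<bullet> z = 0" for z
    using that psd_op_nonneg[OF M, of z] by force
  then show ?thesis by (intro that[of 1]) simp_all
next
  case False
  have "compact ({z. u \<bullet> z = 0} \<inter> sphere 0 1)"
    by (intro closed_Int_compact closed_Collect_eq continuous_intros compact_sphere)
  moreover have "continuous_on ({z. u \<bullet> z = 0} \<inter> sphere 0 1) (\<lambda>z. z \<bullet> M z)"
    using psd_op_linear[OF M]
    by (intro continuous_intros linear_continuous_on) (simp add: linear_conv_bounded_linear)
  ultimately obtain x where x: "u \<bullet> x = 0" "norm x = 1"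
    and min: "\<And>z. u \<bullet> z = 0 \<Longrightarrow> norm z = 1 \<Longrightarrow> x \<bullet> M x \<le> z \<bullet> M z"
    using continuous_attains_inf[OF _ False, of "\<lambda>z. z \<bullet> M z"] by fastforce
  show ?thesis
  proof (rule that)
    show "0 < x \<bullet> M x" using pd x by (auto simp: pos_def_perp_def)
    fix z assume z: "u \<bullet> z = 0"
    show "(x \<bullet> M x) * (norm z)\<^sup>2 \<le> z \<bullet> M z"
    proof (cases "z = 0")
      case True
      then show ?thesis by (simp add: psd_op_nonneg[OF M])
    next
      case False
      then have "x \<bullet> M x \<le> (z /\<^sub>R norm z) \<bullet> M (z /\<^sub>R norm z)" using z by (intro min) auto
      also have "\<dots> = (z \<bullet> M z) / (norm z)\<^sup>2"
        by (simp add: linear_scale[OF psd_op_linear[OF M]] power2_eq_square field_simps)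
      finally show ?thesis using False by (simp add: field_simps)
    qed
  qed
qed

text \<open>The cylinder of height \<open>1\<close> has the same measure as its base. It contains a
  ball around \<open>u /\<^sub>R 2\<close> by coercivity and is bounded by
  \<open>psd_op_bound\<close>.\<close>

lemma slice_pos_finite:
  fixes u :: "'a::euclidean_space"
  assumes u: "norm u = 1" and M: "psd_op M" and pd: "pos_def_perp u M"
  shows "emeasure (perp_lborel u) (slice u M 1) \<noteq> 0" "emeasure (perp_lborel u) (slice u M 1) \<noteq> \<infinity>"
proof -
  let ?C = "cylinder u (slice u M 1) 1"
  have C: "emeasure lborel ?C = emeasure (perp_lborel u) (slice u M 1)"
    using emeasure_cylinder[OF u, of 1 "slice u M 1"] by (simp add: borel_closed closed_slice)
  obtain d where d: "0 < d" "\<And>z. u \<bullet> z = 0 \<Longrightarrow> d * (norm z)\<^sup>2 \<le> z \<bullet> M z"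
    by (rule pos_def_perp_coercive[OF M pd]) blast
  \<comment> \<open>The bound \<open>1 / 2\<close> keeps the heights of the ball between
    \<open>0\<close> and \<open>1\<close>; the bound \<open>sqrt d\<close> yields the slice
    inequality through Cauchy-Schwarz.\<close>
  define e where "e = min (sqrt d) (1 / 2)"
  have e: "0 < e" "e\<^sup>2 \<le> d" "e \<le> 1 / 2"
    using d(1) power_mono[of e "sqrt d" 2] by (auto simp: e_def)
  have "ball (u /\<^sub>R 2) e \<subseteq> ?C"
  proof
    fix x assume "x \<in> ball (u /\<^sub>R 2) e"
    then have x: "norm (x - u /\<^sub>R 2) < e" by (simp add: dist_norm norm_minus_commute)
    have "\<bar>u \<bullet> (x - u /\<^sub>R 2)\<bar> \<le> norm (x - u /\<^sub>R 2)"
      using Cauchy_Schwarz_ineq2[of u "x - u /\<^sub>R 2"] u by simp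
    then have "\<bar>u \<bullet> x - 1 / 2\<bar> \<le> 1 / 2"
      using x e u by (simp add: inner_diff_right norm_eq_1)
    then have "0 \<le> u \<bullet> x" "u \<bullet> x \<le> 1" by linarith+
    moreover have "(z \<bullet> x)\<^sup>2 \<le> z \<bullet> M z" if z: "u \<bullet> z = 0" for z
    proof -
      have "\<bar>z \<bullet> x\<bar> = \<bar>z \<bullet> (x - u /\<^sub>R 2)\<bar>"
        using z by (simp add: inner_diff_right inner_commute)
      also have "\<dots> \<le> norm z * e"
        using Cauchy_Schwarz_ineq2[of z "x - u /\<^sub>R 2"] x
        by (meson less_imp_le mult_left_mono norm_ge_zero order_trans)
      finally have "(z \<bullet> x)\<^sup>2 \<le> (norm z * e)\<^sup>2"
        by (metis abs_ge_zero power2_abs power_mono)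
      also have "\<dots> \<le> d * (norm z)\<^sup>2"
        using e(2) by (simp add: power_mult_distrib mult.commute mult_right_mono)
      also have "\<dots> \<le> z \<bullet> M z" by (rule d(2)[OF z])
      finally show ?thesis .
    qed
    ultimately show "x \<in> ?C"
      by (simp add: cylinder_def slice_def perp_proj_perp[OF u] inner_proj_perp)
  qed
  then have "emeasure lborel (ball (u /\<^sub>R 2) e) \<le> emeasure lborel ?C"
    by (intro emeasure_mono) (auto simp: borel_closed closed_slice)
  moreover have "emeasure lborel (ball (u /\<^sub>R 2) e) \<noteq> 0"
    using content_ball_pos[OF e(1), of "u /\<^sub>R 2"] by (auto simp: measure_def)
  ultimately show "emeasure (perp_lborel u) (slice u M 1) \<noteq> 0"
    by (auto simp: C)
  obtain K where K: "\<And>y. (y \<bullet> y)\<^sup>2 \<le> y \<bullet> M y \<Longrightarrow> norm y \<le> K"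
    by (rule psd_op_bound[OF M]) blast
  have "norm x \<le> K + 1" if "x \<in> ?C" for x
  proof -
    have "norm (proj_perp u x) \<le> K"
      using that by (intro K) (auto simp: cylinder_def slice_def)
    moreover have "norm ((x \<bullet> u) *\<^sub>R u) \<le> 1"
      using that u by (auto simp: cylinder_def inner_commute)
    moreover have "x = proj_perp u x + (x \<bullet> u) *\<^sub>R u"
      by (simp add: proj_perp_def)
    ultimately show ?thesis
      using norm_triangle_ineq[of "proj_perp u x" "(x \<bullet> u) *\<^sub>R u"] by simp
  qed
  then have "bounded ?C" by (auto simp: bounded_iff)
  from emeasure_bounded_finite[OF this] show "emeasure (perp_lborel u) (slice u M 1) \<noteq> \<infinity>"
    by (simp add: C less_top)
qed

section \<open>Conjugate directions and fibres\<close>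

text \<open>Such a \<open>w\<close> minimizes the form of \<open>M\<close> on the affine hyperplane \<open>{x. u \<bullet> x = 1}\<close>.\<close>

definition conjugate_dir :: "'a::euclidean_space \<Rightarrow> ('a \<Rightarrow> 'a) \<Rightarrow> 'a \<Rightarrow> bool" where
  "conjugate_dir u M w \<longleftrightarrow> u \<bullet> w = 1 \<and> (\<forall>z. u \<bullet> z = 0 \<longrightarrow> z \<bullet> M w = 0)"

text \<open>With \<open>w = u + x\<close> and \<open>x\<close> in \<open>u\<^sup>\<bottom>\<close>,
  conjugacy says that \<open>M x\<close> and \<open>- M u\<close> have the same projection to
  \<open>u\<^sup>\<bottom>\<close>. The operator \<open>N\<close> is the compression of
  \<open>M\<close> to \<open>u\<^sup>\<bottom>\<close>, completed by the identity on the line of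
  \<open>u\<close>; it is injective because the form is definite on
  \<open>u\<^sup>\<bottom>\<close>, hence surjective.\<close>

lemma conjugate_dir_exists:
  fixes u :: "'a::euclidean_space"
  assumes u: "norm u = 1" and M: "psd_op M" and pd: "pos_def_perp u M"
  obtains w where "conjugate_dir u M w"
proof -
  note linM = psd_op_linear[OF M]
  have linP: "linear (proj_perp u)"
    unfolding proj_perp_def by (intro linearI) (auto simp: algebra_simps inner_add_left)
  define N where "N x = proj_perp u (M (proj_perp u x)) + (x \<bullet> u) *\<^sub>R u" for x
  have linN: "linear N"
    unfolding N_def
    by (intro linearI) (simp_all add: linear_add[OF linP] linear_add[OF linM] linear_scale[OF linP]
      linear_scale[OF linM] inner_add_left algebra_simps)
  have uN: "u \<bullet> N x = x \<bullet> u" for x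
    using u by (simp add: N_def inner_add_right perp_proj_perp norm_eq_1)
  have "inj N"
  proof (subst linear_injective_0[OF linN], intro allI impI)
    fix x assume x: "N x = 0"
    then have "x \<bullet> u = 0" using uN[of x] by simp
    then have P: "proj_perp u x = x" by (simp add: proj_perp_def)
    have "x \<bullet> M x = x \<bullet> N x"
      using \<open>x \<bullet> u = 0\<close> by (simp add: N_def inner_add_right P inner_proj_perp inner_commute[of u])
    then have "x \<bullet> M x = 0" using x by simp
    then show "x = 0"
      using pd \<open>x \<bullet> u = 0\<close> by (auto simp: pos_def_perp_def inner_commute)
  qed
  then have "surj N" by (rule linear_injective_imp_surjective[OF linN]) (rule refl)
  then obtain x where x: "N x = - proj_perp u (M u)" by (metis surjD)
  \<comment> \<open>\<open>N\<close> preserves the component along \<open>u\<close>, and the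
    right-hand side has none.\<close>
  have xu: "x \<bullet> u = 0"
    using uN[of x] perp_proj_perp[OF u, of "M u"] by (simp add: x)
  have "conjugate_dir u M (u + x)"
    unfolding conjugate_dir_def
  proof (intro conjI allI impI)
    show "u \<bullet> (u + x) = 1" using u xu by (simp add: inner_add_right norm_eq_1 inner_commute)
    fix z assume z: "u \<bullet> z = 0"
    have "proj_perp u (M x) = - proj_perp u (M u)"
      using x xu by (simp add: N_def proj_perp_def[of u x])
    then have "z \<bullet> proj_perp u (M x) = - (z \<bullet> proj_perp u (M u))" by simp
    then show "z \<bullet> M (u + x) = 0"
      using z by (simp add: inner_proj_perp linear_add[OF linM] inner_add_right)
  qed
  then show thesis by (rule that)
qed

text \<open>The cross term contains \<open>z \<bullet> M w\<close>, which vanishes by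
  conjugacy.\<close>

lemma conjugate_dir_form:
  assumes "psd_op M" "conjugate_dir u M w" "u \<bullet> z = 0"
  shows "(z + a *\<^sub>R w) \<bullet> M (z + a *\<^sub>R w) = z \<bullet> M z + a\<^sup>2 * (w \<bullet> M w)"
  using assms by (simp add: psd_op_expand conjugate_dir_def)

lemma conjugate_dir_decomp:
  assumes "conjugate_dir u M w"
  obtains z where "u \<bullet> z = 0" "x = z + (u \<bullet> x) *\<^sub>R w"
  using assms by (intro that[of "x - (u \<bullet> x) *\<^sub>R w"]) (simp_all add: conjugate_dir_def inner_diff_right)

text \<open>Writing test vectors as \<open>z + a *\<^sub>R w\<close> with \<open>z\<close> in
  \<open>u\<^sup>\<bottom>\<close> turns membership into a family of inequalities quadratic in
  \<open>a\<close>. For fixed \<open>z\<close> their discriminant condition is the slice condition.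
  In terms of \<open>tau\<close>, the fibre over \<open>y\<close> is symmetric about the height
  \<open>- (w \<bullet> y)\<close>.\<close>

lemma ellipsoid_fibre:
  assumes M: "psd_op M" and w: "conjugate_dir u M w" and u: "norm u = 1" and y: "u \<bullet> y = 0"
    and s: "0 < w \<bullet> M w" and tau: "tau = w \<bullet> y + t"
  shows "y + t *\<^sub>R u \<in> ellipsoid M \<longleftrightarrow>
    tau\<^sup>2 \<le> w \<bullet> M w \<and> y \<in> slice u M (1 - tau\<^sup>2 / (w \<bullet> M w))"
proof -
  let ?s = "w \<bullet> M w"
  have uw: "u \<bullet> w = 1" using w by (simp add: conjugate_dir_def)
  have ip: "(z + a *\<^sub>R w) \<bullet> (y + t *\<^sub>R u) = z \<bullet> y + a * tau" if "u \<bullet> z = 0" for z a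
    using that uw y
    by (simp add: tau inner_add_left inner_add_right algebra_simps inner_commute[of _ u])
  have mem: "y + t *\<^sub>R u \<in> ellipsoid M \<longleftrightarrow>
      (\<forall>z a. u \<bullet> z = 0 \<longrightarrow> (z \<bullet> y + a * tau)\<^sup>2 \<le> z \<bullet> M z + a\<^sup>2 * ?s)" (is "_ \<longleftrightarrow> ?R")
  proof
    assume *: "y + t *\<^sub>R u \<in> ellipsoid M"
    show ?R
    proof (intro allI impI)
      fix z a assume "u \<bullet> z = 0"
      then show "(z \<bullet> y + a * tau)\<^sup>2 \<le> z \<bullet> M z + a\<^sup>2 * ?s"
        using * ip conjugate_dir_form[OF M w] unfolding ellipsoid_def by (metis (mono_tags) mem_Collect_eq)
    qed
  next
    assume R: ?R
    show "y + t *\<^sub>R u \<in> ellipsoid M"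
      unfolding ellipsoid_def
    proof clarify
      fix x
      obtain z where z: "u \<bullet> z = 0" "x = z + (u \<bullet> x) *\<^sub>R w"
        by (rule conjugate_dir_decomp[OF w])
      then show "(x \<bullet> (y + t *\<^sub>R u))\<^sup>2 \<le> x \<bullet> M x"
        using R ip conjugate_dir_form[OF M w] by metis
    qed
  qed
  show ?thesis
  proof
    assume "y + t *\<^sub>R u \<in> ellipsoid M"
    then have R: "(z \<bullet> y + a * tau)\<^sup>2 \<le> z \<bullet> M z + a\<^sup>2 * ?s" if "u \<bullet> z = 0" for z a
      using mem that by blast
    have ts: "tau\<^sup>2 \<le> ?s" using R[of 0 1] by (simp add: psd_op_def linear_0[OF psd_op_linear[OF M]])
    moreover have "(z \<bullet> y)\<^sup>2 \<le> (1 - tau\<^sup>2 / ?s) * (z \<bullet> M z)" if z: "u \<bullet> z = 0" for z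
    proof -
      \<comment> \<open>For fixed \<open>z\<close> the inequality \<open>R\<close> says that a
        quadratic polynomial in \<open>a\<close> is nonnegative.\<close>
      have "(- (tau * (z \<bullet> y)))\<^sup>2 \<le> (z \<bullet> M z - (z \<bullet> y)\<^sup>2) * (?s - tau\<^sup>2)"
      proof (rule nonneg_quadratic_discriminant)
        show "0 \<le> z \<bullet> M z - (z \<bullet> y)\<^sup>2 + 2 * a * - (tau * (z \<bullet> y)) + a\<^sup>2 * (?s - tau\<^sup>2)" for a
          using R[OF z, of a] by (simp add: power2_eq_square algebra_simps)
      qed (use ts in simp)
      then have "?s * (z \<bullet> y)\<^sup>2 \<le> (?s - tau\<^sup>2) * (z \<bullet> M z)"
        by (simp add: power_mult_distrib algebra_simps)
      then show ?thesis using s by (simp add: field_simps)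
    qed
    ultimately show "tau\<^sup>2 \<le> ?s \<and> y \<in> slice u M (1 - tau\<^sup>2 / ?s)"
      using y by (simp add: slice_def)
  next
    assume *: "tau\<^sup>2 \<le> ?s \<and> y \<in> slice u M (1 - tau\<^sup>2 / ?s)"
    show "y + t *\<^sub>R u \<in> ellipsoid M"
      unfolding mem
    proof (intro allI impI)
      fix z a assume z: "u \<bullet> z = 0"
      let ?q = "z \<bullet> M z" and ?c = "z \<bullet> y"
      have q: "0 \<le> ?q" by (rule psd_op_nonneg[OF M])
      have "?c\<^sup>2 \<le> (1 - tau\<^sup>2 / ?s) * ?q" using * z by (auto simp: slice_def)
      then have c: "?s * ?c\<^sup>2 \<le> (?s - tau\<^sup>2) * ?q"
        using s by (simp add: field_simps)
      have "(tau * ?c)\<^sup>2 \<le> (?q - ?c\<^sup>2) * (?s - tau\<^sup>2)"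
        using c by (simp add: power_mult_distrib algebra_simps)
      show "(?c + a * tau)\<^sup>2 \<le> ?q + a\<^sup>2 * ?s"
      \<comment> \<open>At the ends of the longest chord the leading coefficient in \<open>a\<close>
        vanishes and \<open>c\<close> forces \<open>z \<bullet> y = 0\<close>. Otherwise the square
        in \<open>a\<close> is completed after multiplication by
        \<open>?s - tau\<^sup>2\<close>.\<close>
      proof (cases "tau\<^sup>2 = ?s")
        case True
        then have "?c = 0" using c s by (simp add: mult_le_0_iff)
        then show ?thesis using True q by (simp add: power_mult_distrib)
      next
        case False
        then have m: "0 < ?s - tau\<^sup>2" using * by simp
        have "0 \<le> (a * (?s - tau\<^sup>2) - tau * ?c)\<^sup>2" by simp
        also have "\<dots> = (?s - tau\<^sup>2) * (a\<^sup>2 * (?s - tau\<^sup>2) - 2 * a * tau * ?c) + (tau * ?c)\<^sup>2"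
          by (simp add: power2_eq_square algebra_simps)
        also have "\<dots> \<le> (?s - tau\<^sup>2) * (a\<^sup>2 * (?s - tau\<^sup>2) - 2 * a * tau * ?c) + (?q - ?c\<^sup>2) * (?s - tau\<^sup>2)"
          using \<open>(tau * ?c)\<^sup>2 \<le> _\<close> by simp
        also have "\<dots> = (?s - tau\<^sup>2) * (?q + a\<^sup>2 * ?s - (?c + a * tau)\<^sup>2)"
          by (simp add: power2_eq_square algebra_simps)
        finally show ?thesis using m by (simp add: zero_le_mult_iff)
      qed
    qed
  qed
qed

section \<open>Volume of an ellipsoid\<close>

lemma proj_perp_add:
  assumes "norm u = 1" "u \<bullet> y = 0"
  shows "proj_perp u (y + t *\<^sub>R u) = y" "u \<bullet> (y + t *\<^sub>R u) = t"
  using assms by (simp_all add: proj_perp_def inner_add_left inner_add_right norm_eq_1 inner_commute)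

text \<open>The quotient of the volumes of the unit balls of dimensions \<open>n\<close> and \<open>n - 1\<close>.\<close>

definition dome_const :: "nat \<Rightarrow> ennreal" where
  "dome_const n = (\<integral>\<^sup>+t. indicator {-1<..<1} t * ennreal (sqrt (1 - t\<^sup>2) ^ n / sqrt (1 - t\<^sup>2)) \<partial>lborel)"

text \<open>For \<open>n > 0\<close> the quotient is the power \<open>n - 1\<close> of a number in
  (0,1], so the integrand is at most \<open>1\<close> on a bounded interval.\<close>

lemma dome_const_finite:
  assumes "0 < n"
  shows "dome_const n \<noteq> \<infinity>"
proof -
  have "dome_const n \<le> (\<integral>\<^sup>+t. indicator {-1<..<1::real} t \<partial>lborel)"
    unfolding dome_const_def
  proof (rule nn_integral_mono)
    fix t :: real
    show "indicator {-1<..<1} t * ennreal (sqrt (1 - t\<^sup>2) ^ n / sqrt (1 - t\<^sup>2)) \<le> indicator {-1<..<1} t"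
    proof (cases "t \<in> {-1<..<1}")
      case True
      let ?r = "sqrt (1 - t\<^sup>2)"
      have "0 < ?r" using True by (simp add: abs_square_less_1 abs_less_iff)
      moreover have "?r \<le> 1" by simp
      ultimately have "?r ^ n / ?r \<le> 1"
        using power_decreasing[of 1 n ?r] assms by simp
      then show ?thesis using True by (simp add: ennreal_le_1)
    qed simp
  qed
  also have "\<dots> < \<infinity>" by (simp add: ennreal_less_top)
  finally show ?thesis by simp
qed

lemma dome_const_nonzero: "dome_const n \<noteq> 0"
proof
  assume "dome_const n = 0"
  then have "AE t in lborel. indicator {-1<..<1} t * ennreal (sqrt (1 - t\<^sup>2) ^ n / sqrt (1 - t\<^sup>2)) = 0"
    unfolding dome_const_def by (subst (asm) nn_integral_0_iff_AE) simp_all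
  then have "AE t in lborel. t \<notin> {-1<..<1::real}"
  proof eventually_elim
    fix t :: real
    assume *: "indicator {-1<..<1} t * ennreal (sqrt (1 - t\<^sup>2) ^ n / sqrt (1 - t\<^sup>2)) = 0"
    show "t \<notin> {-1<..<1}"
    proof
      assume t: "t \<in> {-1<..<1}"
      then have "0 < sqrt (1 - t\<^sup>2)" by (simp add: abs_square_less_1 abs_less_iff)
      then have "0 < sqrt (1 - t\<^sup>2) ^ n / sqrt (1 - t\<^sup>2)" by (intro divide_pos_pos zero_less_power)
      then show False using * t by (simp add: ennreal_eq_0_iff)
    qed
  qed
  then have "{-1<..<1::real} \<in> null_sets lborel"
    by (simp add: AE_iff_null_sets)
  then show False by (simp add: null_sets_def)
qed

text \<open>If the minimum \<open>w \<bullet> M w\<close> is \<open>0\<close>, the ellipsoid lies in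
  the hyperplane orthogonal to \<open>w\<close> and both sides vanish. Otherwise an affine
  substitution in each fibre reduces the ellipsoid to a body \<open>D\<close> that depends only on
  the form on \<open>u\<^sup>\<bottom>\<close>, and \<open>D\<close> is measured by its sections at
  constant height.\<close>

lemma emeasure_ellipsoid:
  fixes u :: "'a::euclidean_space"
  assumes u: "norm u = 1" and M: "psd_op M" and w: "conjugate_dir u M w"
  shows "emeasure lborel (ellipsoid M)
    = ennreal (sqrt (w \<bullet> M w)) * (dome_const DIM('a) * emeasure (perp_lborel u) (slice u M 1))"
proof (cases "w \<bullet> M w = 0")
  case True
  have "w \<noteq> 0" using w by (auto simp: conjugate_dir_def)
  moreover have "ellipsoid M \<subseteq> {x. w \<bullet> x = 0}"
    using True by (auto simp: ellipsoid_def) (metis power2_less_eq_zero_iff)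
  ultimately have "negligible (ellipsoid M)"
    by (intro negligible_subset[OF negligible_hyperplane[of w 0]]) auto
  then show ?thesis
    using True by (simp add: negligible_iff_emeasure0 borel_closed closed_ellipsoid[OF M])
next
  case False
  let ?s = "w \<bullet> M w"
  have s: "0 < ?s" using False psd_op_nonneg[OF M, of w] by simp
  \<comment> \<open>The section of \<open>D\<close> at height \<open>t\<close> in (-1,1) is the unit
    slice dilated by \<open>sqrt (1 - t\<^sup>2)\<close>.\<close>
  define D where "D = {x. (u \<bullet> x)\<^sup>2 \<le> 1 \<and> proj_perp u x \<in> slice u M (1 - (u \<bullet> x)\<^sup>2)}"
  have "D = {x. (u \<bullet> x)\<^sup>2 \<le> 1} \<inter>
      (\<Inter>z\<in>{z. u \<bullet> z = 0}. {x. (z \<bullet> x)\<^sup>2 \<le> (1 - (u \<bullet> x)\<^sup>2) * (z \<bullet> M z)})"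
    by (auto simp: D_def slice_def inner_proj_perp perp_proj_perp[OF u])
  also have "closed \<dots>"
    by (intro closed_Int closed_INT ballI closed_Collect_le continuous_intros)
  finally have [measurable]: "D \<in> sets borel" by (rule borel_closed)
  have [measurable]: "ellipsoid M \<in> sets borel" by (intro borel_closed closed_ellipsoid M)
  have [measurable]: "slice u M c \<in> sets borel" for c
    by (rule borel_closed[OF closed_slice])
  let ?E = "\<lambda>c. emeasure (perp_lborel u) (slice u M c)"
  have "emeasure lborel (ellipsoid M) = (\<integral>\<^sup>+x. indicator (ellipsoid M) x \<partial>lborel)" by simp
  also have "\<dots> = (\<integral>\<^sup>+y. (\<integral>\<^sup>+t. indicator (ellipsoid M) (y + t *\<^sub>R u) \<partial>lborel) \<partial>perp_lborel u)"
    by (rule nn_integral_perp_split(1)[OF u]) measurable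
  also have "\<dots> = (\<integral>\<^sup>+y. ennreal (sqrt ?s) * (\<integral>\<^sup>+t. indicator D (y + t *\<^sub>R u) \<partial>lborel) \<partial>perp_lborel u)"
  proof (rule nn_integral_cong_AE)
    show "AE y in perp_lborel u. (\<integral>\<^sup>+t. indicator (ellipsoid M) (y + t *\<^sub>R u) \<partial>lborel)
        = ennreal (sqrt ?s) * (\<integral>\<^sup>+t. indicator D (y + t *\<^sub>R u) \<partial>lborel)"
      using AE_perp_lborel
    proof eventually_elim
      fix y assume y: "u \<bullet> y = 0"
      have "(\<integral>\<^sup>+t. indicator (ellipsoid M) (y + t *\<^sub>R u) \<partial>lborel)
          = ennreal \<bar>sqrt ?s\<bar> *
            (\<integral>\<^sup>+t. indicator (ellipsoid M) (y + (- (w \<bullet> y) + sqrt ?s * t) *\<^sub>R u) \<partial>lborel)"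
        using s by (intro nn_integral_real_affine) auto
      also have "(\<lambda>t. indicator (ellipsoid M) (y + (- (w \<bullet> y) + sqrt ?s * t) *\<^sub>R u) :: ennreal)
          = (\<lambda>t. indicator D (y + t *\<^sub>R u))"
      proof
        fix t
        have "y + (- (w \<bullet> y) + sqrt ?s * t) *\<^sub>R u \<in> ellipsoid M \<longleftrightarrow>
            (sqrt ?s * t)\<^sup>2 \<le> ?s \<and> y \<in> slice u M (1 - (sqrt ?s * t)\<^sup>2 / ?s)"
          by (rule ellipsoid_fibre[OF M w u y s]) simp
        also have "\<dots> \<longleftrightarrow> t\<^sup>2 \<le> 1 \<and> y \<in> slice u M (1 - t\<^sup>2)"
          using s by (simp add: power_mult_distrib)
        also have "\<dots> \<longleftrightarrow> y + t *\<^sub>R u \<in> D"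
          unfolding D_def mem_Collect_eq proj_perp_add[OF u y] ..
        finally show "indicator (ellipsoid M) (y + (- (w \<bullet> y) + sqrt ?s * t) *\<^sub>R u)
            = (indicator D (y + t *\<^sub>R u) :: ennreal)"
          by (simp add: indicator_def)
      qed
      finally show "(\<integral>\<^sup>+t. indicator (ellipsoid M) (y + t *\<^sub>R u) \<partial>lborel)
        = ennreal (sqrt ?s) * (\<integral>\<^sup>+t. indicator D (y + t *\<^sub>R u) \<partial>lborel)"
        using s by simp
    qed
  qed
  also have "\<dots> = ennreal (sqrt ?s) * (\<integral>\<^sup>+y. (\<integral>\<^sup>+t. indicator D (y + t *\<^sub>R u) \<partial>lborel) \<partial>perp_lborel u)"
    by (rule nn_integral_cmult) measurable
  also have "(\<integral>\<^sup>+y. (\<integral>\<^sup>+t. indicator D (y + t *\<^sub>R u) \<partial>lborel) \<partial>perp_lborel u)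
      = (\<integral>\<^sup>+t. (\<integral>\<^sup>+y. indicator D (y + t *\<^sub>R u) \<partial>perp_lborel u) \<partial>lborel)"
    by (rule trans[OF nn_integral_perp_split(1)[OF u, symmetric] nn_integral_perp_split(2)[OF u]])
      measurable
  also have "\<dots> = (\<integral>\<^sup>+t. indicator {-1<..<1} t * ennreal (sqrt (1 - t\<^sup>2) ^ DIM('a) / sqrt (1 - t\<^sup>2)) * ?E 1 \<partial>lborel)"
  proof (rule nn_integral_cong_AE)
    show "AE t in lborel. (\<integral>\<^sup>+y. indicator D (y + t *\<^sub>R u) \<partial>perp_lborel u)
        = indicator {-1<..<1} t * ennreal (sqrt (1 - t\<^sup>2) ^ DIM('a) / sqrt (1 - t\<^sup>2)) * ?E 1"
      \<comment> \<open>The heights \<open>1\<close> and \<open>-1\<close> are discarded because the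
        scaling law for slices requires a positive factor.\<close>
      using AE_lborel_singleton[of 1] AE_lborel_singleton[of "-1"]
    proof eventually_elim
      fix t :: real assume t: "t \<noteq> 1" "t \<noteq> -1"
      have "(\<integral>\<^sup>+y. indicator D (y + t *\<^sub>R u) \<partial>perp_lborel u)
          = (\<integral>\<^sup>+y. indicator {-1..1} t * indicator (slice u M (1 - t\<^sup>2)) y \<partial>perp_lborel u)"
      proof (rule nn_integral_cong_AE)
        show "AE y in perp_lborel u. indicator D (y + t *\<^sub>R u)
            = (indicator {-1..1} t * indicator (slice u M (1 - t\<^sup>2)) y :: ennreal)"
          using AE_perp_lborel
        proof eventually_elim
          fix y assume "u \<bullet> y = 0"
          then show "indicator D (y + t *\<^sub>R u)
              = (indicator {-1..1} t * indicator (slice u M (1 - t\<^sup>2)) y :: ennreal)"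
            by (auto simp: D_def proj_perp_add[OF u] indicator_def abs_square_le_1 abs_le_iff)
        qed
      qed
      also have "\<dots> = indicator {-1..1} t * ?E (1 - t\<^sup>2)"
        by (simp add: nn_integral_cmult)
      also have "\<dots> = indicator {-1<..<1} t * ennreal (sqrt (1 - t\<^sup>2) ^ DIM('a) / sqrt (1 - t\<^sup>2)) * ?E 1"
      proof (cases "t \<in> {-1<..<1}")
        case True
        then have "0 < 1 - t\<^sup>2" by (simp add: abs_square_less_1 abs_less_iff)
        then show ?thesis
          using emeasure_slice_scale[OF u, of "sqrt (1 - t\<^sup>2)" M] True by simp
      next
        case False
        then show ?thesis using t by (auto simp: indicator_def)
      qed
      finally show "(\<integral>\<^sup>+y. indicator D (y + t *\<^sub>R u) \<partial>perp_lborel u)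
        = indicator {-1<..<1} t * ennreal (sqrt (1 - t\<^sup>2) ^ DIM('a) / sqrt (1 - t\<^sup>2)) * ?E 1" .
    qed
  qed
  also have "\<dots> = dome_const DIM('a) * ?E 1"
    unfolding dome_const_def by (rule nn_integral_multc) measurable
  finally show ?thesis .
qed

section \<open>Projections and the volume ratio\<close>

lemma proj_ellipsoid_subset:
  assumes "norm u = 1"
  shows "proj_perp u ` ellipsoid M \<subseteq> slice u M 1"
  using assms by (auto simp: ellipsoid_def slice_def inner_proj_perp perp_proj_perp)

text \<open>A point \<open>y\<close> of the slice is lifted to the centre of its fibre, at height
  \<open>- (w \<bullet> y)\<close>. The lifted point is orthogonal to \<open>w\<close>, so for
  \<open>v = z + a *\<^sub>R w\<close> only the slice inequality for \<open>z\<close>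
  remains.\<close>

lemma proj_ellipsoid:
  assumes u: "norm u = 1" and M: "psd_op M" and w: "conjugate_dir u M w"
  shows "proj_perp u ` ellipsoid M = slice u M 1"
proof (intro equalityI proj_ellipsoid_subset[OF u] subsetI)
  fix y assume y: "y \<in> slice u M 1"
  then have uy: "u \<bullet> y = 0" by (simp add: slice_def)
  have uw: "u \<bullet> w = 1" using w by (simp add: conjugate_dir_def)
  let ?x = "y + (- (w \<bullet> y)) *\<^sub>R u"
  have "(v \<bullet> ?x)\<^sup>2 \<le> v \<bullet> M v" for v
  proof -
    obtain z where z: "u \<bullet> z = 0" "v = z + (u \<bullet> v) *\<^sub>R w"
      by (rule conjugate_dir_decomp[OF w])
    define a where "a = u \<bullet> v"
    have v: "v = z + a *\<^sub>R w" unfolding a_def by (rule z(2))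
    have vx: "v \<bullet> ?x = z \<bullet> y"
      unfolding v using z(1) uw by (simp add: inner_add_left inner_add_right inner_diff_right inner_commute[of _ u])
    have "(v \<bullet> ?x)\<^sup>2 \<le> z \<bullet> M z"
      unfolding vx using y z(1) by (simp add: slice_def)
    moreover have "v \<bullet> M v = z \<bullet> M z + (u \<bullet> v)\<^sup>2 * (w \<bullet> M w)"
      using conjugate_dir_form[OF M w z(1), of "u \<bullet> v"] z(2) by simp
    moreover have "0 \<le> (u \<bullet> v)\<^sup>2 * (w \<bullet> M w)" using psd_op_nonneg[OF M, of w] by simp
    ultimately show ?thesis by linarith
  qed
  then have "?x \<in> ellipsoid M" by (simp add: ellipsoid_def)
  moreover have "y = proj_perp u ?x" using proj_perp_add(1)[OF u uy] by metis
  ultimately show "y \<in> proj_perp u ` ellipsoid M" by blast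
qed

lemma perp_volume_degenerate:
  assumes u: "norm u = 1" and M: "psd_op M" and "\<not> pos_def_perp u M"
  shows "perp_volume u (proj_perp u ` ellipsoid M) = 0"
proof -
  have "emeasure (perp_lborel u) (proj_perp u ` ellipsoid M) \<le> emeasure (perp_lborel u) (slice u M 1)"
    by (intro emeasure_mono proj_ellipsoid_subset u) (simp add: borel_closed closed_slice)
  then show ?thesis
    using slice_degenerate_null[OF assms] by (simp add: perp_volume_def measure_def)
qed

lemma vol_ratio_degenerate:
  assumes "norm u = 1" "psd_op M" "\<not> pos_def_perp u M"
  shows "vol_ratio u (ellipsoid M) = 0"
  using perp_volume_degenerate[OF assms] by (simp add: vol_ratio_def)

text \<open>The measure of the unit slice is a factor of the volume and is the volume of the
  projection; being positive and finite, it cancels.\<close>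

lemma vol_ratio_ellipsoid:
  fixes u :: "'a::euclidean_space"
  assumes u: "norm u = 1" and M: "psd_op M" and pd: "pos_def_perp u M" and w: "conjugate_dir u M w"
  shows "vol_ratio u (ellipsoid M) = enn2real (dome_const DIM('a)) * sqrt (w \<bullet> M w)"
proof -
  have "ellipsoid M \<in> sets borel" by (intro borel_closed closed_ellipsoid M)
  then have "measure lebesgue (ellipsoid M) = measure lborel (ellipsoid M)" by simp
  also have "\<dots> = sqrt (w \<bullet> M w) * (enn2real (dome_const DIM('a)) *
      measure (perp_lborel u) (slice u M 1))"
    unfolding measure_def emeasure_ellipsoid[OF u M w]
    by (simp add: enn2real_mult psd_op_nonneg[OF M])
  finally show ?thesis
    using slice_pos_finite[OF u M pd] 
    by (simp add: vol_ratio_def perp_volume_def proj_ellipsoid[OF u M w] measure_def enn2real_eq_0_iff)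
qed

section \<open>Radial function and tangent hyperplanes\<close>

lemma ray_in_ellipsoid_iff:
  assumes M: "psd_op M" and w: "conjugate_dir u M w"
  shows "a *\<^sub>R u \<in> ellipsoid M \<longleftrightarrow> a\<^sup>2 \<le> w \<bullet> M w"
proof
  assume "a *\<^sub>R u \<in> ellipsoid M"
  then have "(w \<bullet> a *\<^sub>R u)\<^sup>2 \<le> w \<bullet> M w" by (simp add: ellipsoid_def)
  then show "a\<^sup>2 \<le> w \<bullet> M w" using w by (simp add: conjugate_dir_def inner_commute)
next
  assume a: "a\<^sup>2 \<le> w \<bullet> M w"
  have "(v \<bullet> a *\<^sub>R u)\<^sup>2 \<le> v \<bullet> M v" for v
  proof -
    obtain z where z: "u \<bullet> z = 0" "v = z + (u \<bullet> v) *\<^sub>R w"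
      by (rule conjugate_dir_decomp[OF w])
    have "(v \<bullet> a *\<^sub>R u)\<^sup>2 = (u \<bullet> v)\<^sup>2 * a\<^sup>2"
      by (simp add: power_mult_distrib inner_commute mult.commute)
    also have "\<dots> \<le> (u \<bullet> v)\<^sup>2 * (w \<bullet> M w)" by (intro mult_left_mono a) simp
    also have "\<dots> \<le> z \<bullet> M z + (u \<bullet> v)\<^sup>2 * (w \<bullet> M w)" using psd_op_nonneg[OF M, of z] by simp
    also have "\<dots> = v \<bullet> M v"
      using conjugate_dir_form[OF M w z(1), of "u \<bullet> v"] z(2) by simp
    finally show ?thesis .
  qed
  then show "a *\<^sub>R u \<in> ellipsoid M" by (simp add: ellipsoid_def)
qed

lemma radial_fun_ellipsoid:
  assumes M: "psd_op M" and w: "conjugate_dir u M w"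
  shows "radial_fun (ellipsoid M) u = sqrt (w \<bullet> M w)"
  unfolding radial_fun_def
  by (intro cSup_eq_maximum) (auto simp: ray_in_ellipsoid_iff[OF M w] psd_op_nonneg[OF M] intro: real_le_rsqrt)

text \<open>A supporting normal \<open>v\<close> at this point satisfies \<open>v \<bullet> M v
  \<le> (w \<bullet> M w) * (u \<bullet> v)\<^sup>2\<close>, because the support value in direction
  \<open>v\<close> is attained. Decomposing \<open>v\<close> along \<open>w\<close> leaves a
  component in \<open>u\<^sup>\<bottom>\<close> on which the form is at most \<open>0\<close>, so
  \<open>v\<close> is a multiple of \<open>w\<close>. The case \<open>w \<bullet> M w = 0\<close> of
  a flat ellipsoid, with the origin as the point, is included.\<close>

lemma supporting_hyperplane_ellipsoid:
  assumes M: "psd_op M" and pd: "pos_def_perp u M" and w: "conjugate_dir u M w"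
  shows "supporting_hyperplane (ellipsoid M) (sqrt (w \<bullet> M w) *\<^sub>R u) H
    \<longleftrightarrow> H = {x. w \<bullet> x = sqrt (w \<bullet> M w)}"
proof -
  let ?s = "w \<bullet> M w" and ?p = "sqrt (w \<bullet> M w) *\<^sub>R u"
  have uw: "u \<bullet> w = 1" using w by (simp add: conjugate_dir_def)
  have s: "0 \<le> ?s" by (rule psd_op_nonneg[OF M])
  have p: "?p \<in> ellipsoid M" by (simp add: ray_in_ellipsoid_iff[OF M w] s)
  have wp: "w \<bullet> ?p = sqrt ?s" using uw by (simp add: inner_commute)
  show ?thesis
  proof
    assume "supporting_hyperplane (ellipsoid M) ?p H"
    then obtain v where v: "v \<noteq> 0" "H = {x. v \<bullet> x = v \<bullet> ?p}" "\<And>x. x \<in> ellipsoid M \<Longrightarrow> v \<bullet> x \<le> v \<bullet> ?p"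
      unfolding supporting_hyperplane_def by blast
    obtain y where "y \<in> ellipsoid M" "v \<bullet> y = sqrt (v \<bullet> M v)"
      by (rule ellipsoid_support_attained[OF M])
    then have "sqrt (v \<bullet> M v) \<le> sqrt ?s * (u \<bullet> v)"
      using v(3) by (metis inner_commute inner_scaleR_right)
    moreover have "0 \<le> sqrt (v \<bullet> M v)" using psd_op_nonneg[OF M] by simp
    ultimately have "(sqrt (v \<bullet> M v))\<^sup>2 \<le> (sqrt ?s * (u \<bullet> v))\<^sup>2" by (rule power_mono)
    then have le: "v \<bullet> M v \<le> ?s * (u \<bullet> v)\<^sup>2"
      using psd_op_nonneg[OF M, of v] s by (simp add: power_mult_distrib)
    obtain z where z: "u \<bullet> z = 0" "v = z + (u \<bullet> v) *\<^sub>R w"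
      by (rule conjugate_dir_decomp[OF w])
    have "z \<bullet> M z \<le> 0"
      using le conjugate_dir_form[OF M w z(1), of "u \<bullet> v"] z(2) by (simp add: mult.commute)
    then have "z = 0" using pd z(1) unfolding pos_def_perp_def by force
    then have v': "v = (u \<bullet> v) *\<^sub>R w" using z(2) by simp
    then have "u \<bullet> v \<noteq> 0" using v(1) by auto
    have vx: "v \<bullet> x = (u \<bullet> v) * (w \<bullet> x)" for x
      by (metis v' inner_scaleR_left)
    have "v \<bullet> x = v \<bullet> ?p \<longleftrightarrow> w \<bullet> x = w \<bullet> ?p" for x
      unfolding vx[of x] vx[of ?p] mult_cancel_left using \<open>u \<bullet> v \<noteq> 0\<close> by blast
    then show "H = {x. w \<bullet> x = sqrt ?s}"
      unfolding v(2) wp by blast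
  next
    assume H: "H = {x. w \<bullet> x = sqrt ?s}"
    have "w \<noteq> 0" using uw by auto
    moreover have "w \<bullet> x \<le> sqrt ?s" if "x \<in> ellipsoid M" for x
      using that ellipsoid_iff_sqrt[OF M] by blast
    ultimately show "supporting_hyperplane (ellipsoid M) ?p H"
      unfolding supporting_hyperplane_def H using p wp by auto
  qed
qed

lemma tangent_hyperplane_ellipsoid:
  assumes "psd_op M" "pos_def_perp u M" "conjugate_dir u M w"
  shows "tangent_hyperplane (ellipsoid M) (radial_fun (ellipsoid M) u *\<^sub>R u) H
    \<longleftrightarrow> H = {x. w \<bullet> x = sqrt (w \<bullet> M w)}"
  unfolding tangent_hyperplane_def radial_fun_ellipsoid[OF assms(1,3)]
    supporting_hyperplane_ellipsoid[OF assms] by auto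

text \<open>Normals of parallel hyperplanes are proportional, and the normalization against
  \<open>u\<close> makes them equal. In the proof \<open>?y\<close> is a direction inside the first
  hyperplane, hence orthogonal to \<open>w\<close>.\<close>

lemma affine_parallel_hyperplanes_iff:
  fixes v w u :: "'a::euclidean_space"
  assumes v: "u \<bullet> v = 1" and w: "u \<bullet> w = 1"
  shows "affine_parallel {x. v \<bullet> x = a} {x. w \<bullet> x = b} \<longleftrightarrow> v = w"
proof
  assume "affine_parallel {x. v \<bullet> x = a} {x. w \<bullet> x = b}"
  then obtain d where d: "{x. w \<bullet> x = b} = (\<lambda>x. d + x) ` {x. v \<bullet> x = a}"
    unfolding affine_parallel_def by blast
  have shift: "w \<bullet> (d + x) = b" if "v \<bullet> x = a" for x
    using d that by blast
  have "z \<bullet> v = z \<bullet> w" for z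
  proof -
    let ?y = "z - (z \<bullet> v) *\<^sub>R u"
    have "v \<bullet> (a *\<^sub>R u) = a" "v \<bullet> (a *\<^sub>R u + ?y) = a"
      using v by (simp_all add: inner_add_right inner_diff_right inner_commute)
    from shift[OF this(1)] shift[OF this(2)] have "w \<bullet> ?y = 0"
      by (simp add: inner_add_right)
    then show ?thesis using w by (simp add: inner_diff_right inner_commute)
  qed
  then show "v = w" by (metis vector_eq_rdot inner_commute)
next
  assume "v = w"
  have "x \<in> (\<lambda>x. (b - a) *\<^sub>R u + x) ` {x. w \<bullet> x = a}" if "w \<bullet> x = b" for x
    using that w by (intro image_eqI[of _ _ "x - (b - a) *\<^sub>R u"]) (simp_all add: inner_diff_right inner_commute)
  then have "{x. w \<bullet> x = b} = (\<lambda>x. (b - a) *\<^sub>R u + x) ` {x. w \<bullet> x = a}"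
    using w by (auto simp: inner_add_right inner_commute)
  then show "affine_parallel {x. v \<bullet> x = a} {x. w \<bullet> x = b}"
    unfolding affine_parallel_def \<open>v = w\<close> by blast
qed

lemma parallel_tangents_ellipsoid_iff:
  assumes "psd_op M" "pos_def_perp u M" "conjugate_dir u M v"
    and "psd_op N" "pos_def_perp u N" "conjugate_dir u N w"
  shows "parallel_tangents_at (ellipsoid M) (radial_fun (ellipsoid M) u *\<^sub>R u)
      (ellipsoid N) (radial_fun (ellipsoid N) u *\<^sub>R u) \<longleftrightarrow> v = w"
  using assms(3,6) unfolding parallel_tangents_at_def tangent_hyperplane_ellipsoid[OF assms(1-3)]
    tangent_hyperplane_ellipsoid[OF assms(4-6)] conjugate_dir_def
  by (auto simp: affine_parallel_hyperplanes_iff)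

section \<open>Superadditivity of the minimum and the equality case\<close>

lemma conjugate_dir_min:
  assumes "psd_op M" "conjugate_dir u M w" "u \<bullet> x = 1"
  shows "x \<bullet> M x = w \<bullet> M w + (x - w) \<bullet> M (x - w)"
  using conjugate_dir_form[OF assms(1,2), of "x - w" 1] assms(2,3)
  by (simp add: conjugate_dir_def inner_diff_right)

lemma pos_def_perp_add:
  assumes "psd_op M" "psd_op N" "pos_def_perp u M \<or> pos_def_perp u N"
  shows "pos_def_perp u (\<lambda>x. M x + N x)"
  using assms(3) psd_op_nonneg[OF assms(1)] psd_op_nonneg[OF assms(2)]
  unfolding pos_def_perp_def inner_add_right by (metis add_nonneg_pos add_pos_nonneg)

text \<open>Provides the inequality when the projection of the other ellipsoid degenerates and its
  ratio is \<open>0\<close>.\<close>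

lemma vol_ratio_add_mono:
  fixes u :: "'a::euclidean_space"
  assumes u: "norm u = 1" and M: "psd_op M" and N: "psd_op N" and pd: "pos_def_perp u M"
  shows "(vol_ratio u (ellipsoid M))\<^sup>2 \<le> (vol_ratio u (ellipsoid (\<lambda>x. M x + N x)))\<^sup>2"
proof -
  note MN = psd_op_add[OF M N] and pdMN = pos_def_perp_add[OF M N disjI1[OF pd]]
  obtain v where v: "conjugate_dir u M v" by (rule conjugate_dir_exists[OF u M pd])
  obtain w where w: "conjugate_dir u (\<lambda>x. M x + N x) w" by (rule conjugate_dir_exists[OF u MN pdMN])
  have uw: "u \<bullet> w = 1" using w by (simp add: conjugate_dir_def)
  have "v \<bullet> M v \<le> w \<bullet> M w"
    using conjugate_dir_min[OF M v uw] psd_op_nonneg[OF M, of "w - v"] by simp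
  also have "\<dots> \<le> w \<bullet> (M w + N w)"
    using psd_op_nonneg[OF N, of w] by (simp add: inner_add_right)
  finally show ?thesis
    unfolding vol_ratio_ellipsoid[OF u M pd v] vol_ratio_ellipsoid[OF u MN pdMN w]
    by (intro power_mono mult_left_mono real_sqrt_le_mono) (auto simp: psd_op_nonneg[OF M])
qed

text \<open>The minimizer \<open>w\<close> of the sum competes in both separate minimization
  problems and exceeds the two minima by exactly \<open>dM\<close> and \<open>dN\<close>. The defect
  in the inequality is thus \<open>c * (dM + dN)\<close> with \<open>c > 0\<close>, and by
  definiteness it vanishes iff \<open>w\<close> is also the minimizer for both summands.\<close>

lemma vol_ratio_add:
  fixes u :: "'a::euclidean_space"
  assumes u: "norm u = 1" and M: "psd_op M" and N: "psd_op N"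
    and pdM: "pos_def_perp u M" and pdN: "pos_def_perp u N"
    and v: "conjugate_dir u M v" and v': "conjugate_dir u N v'"
  shows "(vol_ratio u (ellipsoid M))\<^sup>2 + (vol_ratio u (ellipsoid N))\<^sup>2
      \<le> (vol_ratio u (ellipsoid (\<lambda>x. M x + N x)))\<^sup>2" (is ?le)
    and "(vol_ratio u (ellipsoid (\<lambda>x. M x + N x)))\<^sup>2
      = (vol_ratio u (ellipsoid M))\<^sup>2 + (vol_ratio u (ellipsoid N))\<^sup>2 \<longleftrightarrow> v = v'" (is ?eq)
proof -
  note MN = psd_op_add[OF M N] and pdMN = pos_def_perp_add[OF M N disjI1[OF pdM]]
  obtain w where w: "conjugate_dir u (\<lambda>x. M x + N x) w" by (rule conjugate_dir_exists[OF u MN pdMN])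
  have uv: "u \<bullet> v = 1" "u \<bullet> v' = 1" "u \<bullet> w = 1"
    using v v' w by (simp_all add: conjugate_dir_def)
  define c where "c = (enn2real (dome_const DIM('a)))\<^sup>2"
  have c: "0 < c"
    unfolding c_def using dome_const_finite[of "DIM('a)"] dome_const_nonzero[of "DIM('a)"]
    by (simp add: enn2real_eq_0_iff)
  define dM where "dM = (w - v) \<bullet> M (w - v)"
  define dN where "dN = (w - v') \<bullet> N (w - v')"
  have nn: "0 \<le> dM" "0 \<le> dN"
    by (simp_all add: dM_def dN_def psd_op_nonneg M N)
  have sum: "(vol_ratio u (ellipsoid (\<lambda>x. M x + N x)))\<^sup>2
      = (vol_ratio u (ellipsoid M))\<^sup>2 + (vol_ratio u (ellipsoid N))\<^sup>2 + c * (dM + dN)"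
  proof -
    have "w \<bullet> (M w + N w) = v \<bullet> M v + v' \<bullet> N v' + (dM + dN)"
      using conjugate_dir_min[OF M v uv(3)] conjugate_dir_min[OF N v' uv(3)]
      unfolding dM_def dN_def inner_add_right by linarith
    then show ?thesis
      unfolding vol_ratio_ellipsoid[OF u M pdM v] vol_ratio_ellipsoid[OF u N pdN v']
        vol_ratio_ellipsoid[OF u MN pdMN w] power_mult_distrib c_def[symmetric]
      using nn psd_op_nonneg[OF M, of v] psd_op_nonneg[OF N, of v']
      by (simp add: distrib_left)
  qed
  then show ?le using c nn by simp
  have "dM + dN = 0 \<longleftrightarrow> v = v'"
  proof
    assume "dM + dN = 0"
    then have "dM = 0" "dN = 0" using nn by auto
    moreover have "u \<bullet> (w - v) = 0" "u \<bullet> (w - v') = 0"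
      using uv by (simp_all add: inner_diff_right)
    ultimately have "w - v = 0" "w - v' = 0"
      using pdM pdN unfolding pos_def_perp_def dM_def dN_def by (metis less_irrefl)+
    then show "v = v'" by simp
  next
    assume eq: "v = v'"
    let ?z = "w - v"
    have z: "u \<bullet> ?z = 0" using uv by (simp add: inner_diff_right)
    \<comment> \<open>A common minimizer \<open>v\<close> is conjugate for the sum as well.
      Subtracting its relation from that of \<open>w\<close>, both tested with \<open>?z\<close>,
      gives \<open>dM + dN = 0\<close>.\<close>
    have "?z \<bullet> M v + ?z \<bullet> N v = 0" "?z \<bullet> M w + ?z \<bullet> N w = 0"
      using v v' w z unfolding eq conjugate_dir_def inner_add_right by auto
    then show "dM + dN = 0"
      unfolding dM_def dN_def eq[symmetric]
      by (simp add: linear_diff[OF psd_op_linear[OF M]] linear_diff[OF psd_op_linear[OF N]] inner_diff_right)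
  qed
  then show ?eq unfolding sum using c by simp
qed

theorem theorem6p2:
  fixes A B :: "(real ^ 'n) set" and u :: "real ^ 'n"
  assumes "lp_zonoid 2 A" and "lp_zonoid 2 B" and "u \<in> sphere 0 1"
  shows "(vol_ratio u (lp_sum 2 A B))\<^sup>2 \<ge> (vol_ratio u A)\<^sup>2 + (vol_ratio u B)\<^sup>2 \<and>
    (perp_volume u (proj_perp u ` A) > 0 \<and> perp_volume u (proj_perp u ` B) > 0 \<longrightarrow>
      ((vol_ratio u (lp_sum 2 A B))\<^sup>2 = (vol_ratio u A)\<^sup>2 + (vol_ratio u B)\<^sup>2 \<longleftrightarrow>
       parallel_tangents_at A (radial_fun A u *\<^sub>R u) B (radial_fun B u *\<^sub>R u)))"
proof -
  have u: "norm u = 1" using assms(3) by simp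
  obtain M where M: "psd_op M" "A = ellipsoid M" by (rule lp_zonoid_2_ellipsoid[OF assms(1)])
  obtain N where N: "psd_op N" "B = ellipsoid N" by (rule lp_zonoid_2_ellipsoid[OF assms(2)])
  have sum: "lp_sum 2 A B = ellipsoid (\<lambda>x. M x + N x)"
    unfolding M(2) N(2) by (rule lp_sum_ellipsoid[OF M(1) N(1)])
  show ?thesis
  proof (cases "pos_def_perp u M \<and> pos_def_perp u N")
    case True
    then obtain v v' where v: "conjugate_dir u M v" and v': "conjugate_dir u N v'"
      using conjugate_dir_exists[OF u] M(1) N(1) by metis
    show ?thesis
      using vol_ratio_add[OF u M(1) N(1) conjunct1[OF True] conjunct2[OF True] v v']
        parallel_tangents_ellipsoid_iff[OF M(1) conjunct1[OF True] v N(1) conjunct2[OF True] v']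
      unfolding sum by (simp add: M(2) N(2))
  next
    \<comment> \<open>A form degenerate on \<open>u\<^sup>\<bottom>\<close> has a null projection
      and ratio \<open>0\<close>. The equality clause is then vacuous, and the inequality reduces to
      monotonicity or to the nonnegativity of a square.\<close>
    case False
    have comm: "(\<lambda>x. N x + M x) = (\<lambda>x. M x + N x)" by (simp add: add.commute)
    from False have "\<not> (perp_volume u (proj_perp u ` A) > 0 \<and> perp_volume u (proj_perp u ` B) > 0)"
      using perp_volume_degenerate[OF u] M N by (metis less_irrefl)
    moreover have "(vol_ratio u A)\<^sup>2 + (vol_ratio u B)\<^sup>2 \<le> (vol_ratio u (lp_sum 2 A B))\<^sup>2"
      using False vol_ratio_degenerate[OF u M(1)] vol_ratio_degenerate[OF u N(1)]
        vol_ratio_add_mono[OF u M(1) N(1)] vol_ratio_add_mono[OF u N(1) M(1)]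
      unfolding sum comm unfolding M(2) N(2)
      by (cases "pos_def_perp u M"; cases "pos_def_perp u N") auto
    ultimately show ?thesis by blast
  qed
qed

end
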